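(* Let $A$ and $B$ be power bounded operators on a complex Hilbert space $(\mathcal H,\langle\cdot\,;\cdot\rangle)$, let $m$ be a positive integer, and let $P$ be an invertible positive (i.e., strictly positive) operator on $\mathcal H$ such that $(A,B)$ is an $(m,P)$-biisometric pair, i.e., $$\sum_{j=0}^m(-1)^j\binom{m}{j}A^{*(m-j)}PB^{m-j}=O.$$ Then: (a) Either (i) there exists a unitary operator $U$ on $\mathcal H$ such that $A$ and $B$ are similar to $U$; or (ii) there exist nonzero vectors $v\in\mathcal N(A^* )$ and $w\in\mathcal N(B^* )$ such that the sequences $\phi_n=A^nP^{-1}w$ and $\psi_n=B^nP^{-1}v$ ($n\ge0$) are biorthogonal with respect to the inner product $\langle\cdot\,;\cdot\rangle_P=\langle P\,\cdot\,;\cdot\rangle$, i.e., $\langle\phi_k\,;\psi_n\rangle_P=\delta_{k,n}$ for all $k,n\ge0$, and moreover, for every $n\ge0$, $$A\phi_n=\phi_{n+1},\quad B\psi_n=\psi_{n+1},\quad A^*(P\psi_{n+1})=P\psi_n,\quad B^*(P\phi_{n+1})=P\phi_n.$$ (b) Furthermore, in case (a)(i): if $A$ and $A^{-1}$ are either normaloid or convexoid or spectraloid (all combinations are allowed), then $A$ is unitary and $B=P^{-1}AP$; respectively, if $B$ and $B^{-1}$ are either normaloid or convexoid or spectraloid (all combinations are allowed), then $B$ is unitary and $A=PBP^{-1}$.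
   Context: An operator on $\mathcal H$ is a bounded linear map of $\mathcal H$ into itself; $A^*$ is the adjoint with respect to $\langle\cdot\,;\cdot\rangle$; $\mathcal N(\cdot)$ denotes kernel; $O$ is the null operator. A strictly positive operator $P$ is a self-adjoint nonnegative operator that is invertible with a bounded inverse. An operator $T$ is power bounded if $\sup_n\|T^n\|<\infty$. Two operators $T,S$ on $\mathcal H$ are similar if there is an invertible operator $Q$ (with bounded inverse) with $T=Q^{-1}SQ$. $\delta_{k,n}$ is the Kronecker delta. The numerical range of $T$ is $W(T)=\{\langle Tx\,;x\rangle: x\in\mathcal H,\ \|x\|=1\}$, its numerical radius is $w(T)=\sup\{|\lambda|:\lambda\in W(T)\}$, and its spectral radius is $r(T)=\sup\{|\lambda|:\lambda\in\sigma(T)\}=\lim_n\|T^n\|^{1/n}$, where $\sigma(T)$ is the spectrum of $T$. $T$ is normaloid if $r(T)=\|T\|$; convexoid if the closure of $W(T)$ equals the convex hull of $\sigma(T)$; spectraloid if $r(T)=w(T)$.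
   Formalization: In the last clause of (b) the conclusion A = PBP^{-1} is replaced by A = P^{-1}BP; as printed it is false, e.g. for m = 1, P = diag(1,2), B the coordinate swap on C^2 and A = P^{-1}BP. *)

theory Defs
  imports "HOL-Analysis.Analysis"
begin

text \<open>
  A complex Hilbert space, built on the library's real inner product spaces: the real inner
  product is the real part of the complex one, so \<open>norm x = sqrt (Re (cinner x x))\<close> and
  completeness is with respect to this norm.  The complex inner product is linear in its
  first argument.
\<close>

class complex_hilbert_space = real_inner + complete_space +
  fixes scaleC :: "complex \<Rightarrow> 'a \<Rightarrow> 'a"  (infixr \<open>*\<^sub>C\<close> 75)
    and cinner :: "'a \<Rightarrow> 'a \<Rightarrow> complex"
  assumes scaleC_add_right: "a *\<^sub>C (x + y) = a *\<^sub>C x + a *\<^sub>C y"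
    and scaleC_add_left: "(a + b) *\<^sub>C x = a *\<^sub>C x + b *\<^sub>C x"
    and scaleC_scaleC: "a *\<^sub>C (b *\<^sub>C x) = (a * b) *\<^sub>C x"
    and scaleR_eq_scaleC: "scaleR r x = complex_of_real r *\<^sub>C x"
    and cinner_commute: "cinner x y = cnj (cinner y x)"
    and cinner_add_left: "cinner (x + y) z = cinner x z + cinner y z"
    and cinner_scaleC_left: "cinner (a *\<^sub>C x) y = a * cinner x y"
    and inner_eq_Re_cinner: "inner x y = Re (cinner x y)"

instantiation complex :: complex_hilbert_space
begin
definition scaleC_complex :: "complex \<Rightarrow> complex \<Rightarrow> complex" where
  "scaleC_complex a x = a * x"
definition cinner_complex :: "complex \<Rightarrow> complex \<Rightarrow> complex" where
  "cinner_complex x y = x * cnj y"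
instance
  by standard
    (simp_all add: scaleC_complex_def cinner_complex_def algebra_simps scaleR_conv_of_real
      inner_complex_def)
end

text \<open>
  Operators are functions satisfying the predicate \<open>bounded_op\<close>; the operator norm of \<open>T\<close> is the
  library's \<open>onorm T\<close>, powers are \<open>T ^^ n\<close>, and the inverse of an invertible operator is \<open>inv T\<close>.
\<close>

definition bounded_op :: "('a::complex_hilbert_space \<Rightarrow> 'a) \<Rightarrow> bool" where
  "bounded_op T \<longleftrightarrow> bounded_linear T \<and> (\<forall>a x. T (a *\<^sub>C x) = a *\<^sub>C T x)"

definition invertible_op :: "('a::complex_hilbert_space \<Rightarrow> 'a) \<Rightarrow> bool" where
  "invertible_op T \<longleftrightarrow>
     bounded_op T \<and> (\<exists>S. bounded_op S \<and> S \<circ> T = id \<and> T \<circ> S = id)"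

text \<open>For every bounded operator the adjoint exists, by the Riesz representation theorem.\<close>

definition adj :: "('a::complex_hilbert_space \<Rightarrow> 'a) \<Rightarrow> 'a \<Rightarrow> 'a" where
  "adj T = (THE S. \<forall>x y. cinner (T x) y = cinner x (S y))"

lemma adj_eqI:
  fixes T S :: "'a::complex_hilbert_space \<Rightarrow> 'a"
  assumes "\<And>x y. cinner (T x) y = cinner x (S y)"
  shows "adj T = S"
  unfolding adj_def
proof (rule the_equality)
  show "\<forall>x y. cinner (T x) y = cinner x (S y)" using assms by blast
  fix R assume R: "\<forall>x y. cinner (T x) y = cinner x (R y)"
  show "R = S"
  proof
    fix y
    have "inner x (R y) = inner x (S y)" for x
      by (metis R assms inner_eq_Re_cinner)
    then show "R y = S y" using vector_eq_ldot by blast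
  qed
qed

definition kernel_op :: "('a::complex_hilbert_space \<Rightarrow> 'a) \<Rightarrow> 'a set" where
  "kernel_op T = {x. T x = 0}"

definition unitary :: "('a::complex_hilbert_space \<Rightarrow> 'a) \<Rightarrow> bool" where
  "unitary U \<longleftrightarrow> bounded_op U \<and> adj U \<circ> U = id \<and> U \<circ> adj U = id"

text \<open>Self-adjointness makes \<open>cinner (P x) x\<close> real.\<close>

definition strictly_positive :: "('a::complex_hilbert_space \<Rightarrow> 'a) \<Rightarrow> bool" where
  "strictly_positive P \<longleftrightarrow>
     bounded_op P \<and> adj P = P \<and> (\<forall>x. 0 \<le> Re (cinner (P x) x)) \<and> invertible_op P"

definition power_bounded :: "('a::complex_hilbert_space \<Rightarrow> 'a) \<Rightarrow> bool" where
  "power_bounded T \<longleftrightarrow> bounded_op T \<and> bdd_above (range (\<lambda>n. onorm (T ^^ n)))"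

definition similar_op :: "('a::complex_hilbert_space \<Rightarrow> 'a) \<Rightarrow> ('a \<Rightarrow> 'a) \<Rightarrow> bool" where
  "similar_op T S \<longleftrightarrow> (\<exists>Q. invertible_op Q \<and> T = inv Q \<circ> S \<circ> Q)"

definition biisometric_pair ::
  "nat \<Rightarrow> ('a::complex_hilbert_space \<Rightarrow> 'a) \<Rightarrow> ('a \<Rightarrow> 'a) \<Rightarrow> ('a \<Rightarrow> 'a) \<Rightarrow> bool" where
  "biisometric_pair m P A B \<longleftrightarrow>
     (\<forall>x. (\<Sum>j = 0..m. ((-1) ^ j * of_nat (m choose j)) *\<^sub>C
              ((adj A ^^ (m - j)) \<circ> P \<circ> (B ^^ (m - j))) x) = 0)"

definition cinner_wrt ::
  "('a::complex_hilbert_space \<Rightarrow> 'a) \<Rightarrow> 'a \<Rightarrow> 'a \<Rightarrow> complex" where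
  "cinner_wrt P x y = cinner (P x) y"

definition biorthogonal_wrt ::
  "('a::complex_hilbert_space \<Rightarrow> 'a) \<Rightarrow> (nat \<Rightarrow> 'a) \<Rightarrow> (nat \<Rightarrow> 'a) \<Rightarrow> bool" where
  "biorthogonal_wrt P \<phi> \<psi> \<longleftrightarrow>
     (\<forall>k n. cinner_wrt P (\<phi> k) (\<psi> n) = (if k = n then 1 else 0))"

definition spectrum :: "('a::complex_hilbert_space \<Rightarrow> 'a) \<Rightarrow> complex set" where
  "spectrum T = {c. \<not> invertible_op (\<lambda>x. c *\<^sub>C x - T x)}"

definition spectral_radius :: "('a::complex_hilbert_space \<Rightarrow> 'a) \<Rightarrow> real" where
  "spectral_radius T = Sup {cmod c | c. c \<in> spectrum T}"

definition numerical_range :: "('a::complex_hilbert_space \<Rightarrow> 'a) \<Rightarrow> complex set" where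
  "numerical_range T = {cinner (T x) x | x. norm x = 1}"

definition numerical_radius :: "('a::complex_hilbert_space \<Rightarrow> 'a) \<Rightarrow> real" where
  "numerical_radius T = Sup {cmod c | c. c \<in> numerical_range T}"

definition normaloid :: "('a::complex_hilbert_space \<Rightarrow> 'a) \<Rightarrow> bool" where
  "normaloid T \<longleftrightarrow> spectral_radius T = onorm T"

definition convexoid :: "('a::complex_hilbert_space \<Rightarrow> 'a) \<Rightarrow> bool" where
  "convexoid T \<longleftrightarrow> closure (numerical_range T) = convex hull (spectrum T)"

definition spectraloid :: "('a::complex_hilbert_space \<Rightarrow> 'a) \<Rightarrow> bool" where
  "spectraloid T \<longleftrightarrow> spectral_radius T = numerical_radius T"

end

theory Submission
  imports Defs
begin

text \<open>
  Put \<open>\<Phi> X = A\<^sup>* X B\<close>.  Power boundedness makes \<open>n \<mapsto> \<Phi>\<^sup>n P\<close> bounded, and the \<open>(m, P)\<close>-biisometry makes it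
  polynomial, so it is constant: \<open>A\<^sup>* P B = P\<close>.  If \<open>B\<close> is onto, then \<open>A\<close> and \<open>B\<close> are invertible with
  all integer powers uniformly bounded, \<open>A\<close> is similar to a unitary operator by Sz.-Nagy's theorem, and
  \<open>B\<close> is similar to \<open>A\<^sup>*\<^sup>-\<^sup>1\<close>.  Otherwise the left inverses of \<open>A\<close> and \<open>B\<close> provide idempotents
  onto their ranges, and the kernels of the adjoint idempotents contain the required vectors.

  In the second part all three hypotheses say that \<open>A\<close> and its inverse have numerical radius at most
  the spectral radius, which is 1; thus \<open>\<bar>\<langle>A x, x\<rangle>\<bar> \<le> min (norm x ^ 2) (norm (A x) ^ 2)\<close>.  Averaged over
  \<open>x = (\<Sum>k. z ^ k * c k * A ^ k y)\<close> with \<open>z\<close> on the unit circle, this bounds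
  \<open>\<bar>\<Sum>k. (c k) ^ 2 * V k\<bar>\<close> by a multiple of \<open>\<Sum>k. (c (k + 1) - c k) ^ 2\<close>, where
  \<open>V k = norm (A ^ (k + 1) y) ^ 2 - norm (A ^ k y) ^ 2\<close>.  Varying a wide tent \<open>c\<close> at one point forces
  \<open>V = 0\<close>, so \<open>A\<close> is isometric.
\<close>

\<comment> \<open>Algebra of the complex inner product, and the Riesz representation theorem\<close>
subclass (in complex_hilbert_space) banach ..

lemma cinner_add_right: "cinner (x::'a::complex_hilbert_space) (y + z) = cinner x y + cinner x z"
  by (metis cinner_add_left cinner_commute complex_cnj_add)

lemma cinner_scaleC_right: "cinner (x::'a::complex_hilbert_space) (a *\<^sub>C y) = cnj a * cinner x y"
  by (metis cinner_scaleC_left cinner_commute complex_cnj_mult)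

lemma scaleC_zero_left [simp]: "0 *\<^sub>C (x::'a::complex_hilbert_space) = 0"
  by (metis add_cancel_right_right scaleC_add_left)

lemma scaleC_zero_right [simp]: "a *\<^sub>C (0::'a::complex_hilbert_space) = 0"
  by (metis add_cancel_right_right scaleC_add_right)

lemma scaleC_one [simp]: "1 *\<^sub>C (x::'a::complex_hilbert_space) = x"
  by (metis of_real_1 scaleR_eq_scaleC scaleR_one)

lemma cinner_zero_left [simp]: "cinner 0 (x::'a::complex_hilbert_space) = 0"
  by (metis add_cancel_right_right cinner_add_left)

lemma cinner_zero_right [simp]: "cinner (x::'a::complex_hilbert_space) 0 = 0"
  by (metis add_cancel_right_right cinner_add_right)

lemma scaleC_minus_one: "(-1) *\<^sub>C (x::'a::complex_hilbert_space) = - x"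
proof -
  have "(-1) *\<^sub>C x + 1 *\<^sub>C x = 0"
    by (simp only: scaleC_add_left [symmetric]) simp
  then show ?thesis by (simp add: eq_neg_iff_add_eq_0)
qed

lemma scaleC_minus_right: "a *\<^sub>C (- x::'a::complex_hilbert_space) = - (a *\<^sub>C x)"
  by (metis mult.commute scaleC_scaleC scaleC_minus_one)

lemma scaleC_diff_right: "a *\<^sub>C (x - y::'a::complex_hilbert_space) = a *\<^sub>C x - a *\<^sub>C y"
  by (metis diff_conv_add_uminus scaleC_add_right scaleC_minus_right)

lemma cinner_minus_left: "cinner (- x) (y::'a::complex_hilbert_space) = - cinner x y"
  by (metis cinner_scaleC_left mult_minus1 scaleC_minus_one)

lemma cinner_minus_right: "cinner x (- y::'a::complex_hilbert_space) = - cinner x y"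
  by (metis cinner_commute cinner_minus_left complex_cnj_minus)

lemma cinner_diff_left: "cinner (x - y) (z::'a::complex_hilbert_space) = cinner x z - cinner y z"
  by (metis cinner_add_left cinner_minus_left diff_conv_add_uminus)

lemma cinner_diff_right: "cinner z (x - y::'a::complex_hilbert_space) = cinner z x - cinner z y"
  by (metis cinner_add_right cinner_minus_right diff_conv_add_uminus)

lemma cinner_sum_left: "cinner (sum f S) (y::'a::complex_hilbert_space) = (\<Sum>i\<in>S. cinner (f i) y)"
  by (induction S rule: infinite_finite_induct) (auto simp: cinner_add_left)

lemma cinner_sum_right: "cinner (y::'a::complex_hilbert_space) (sum f S) = (\<Sum>i\<in>S. cinner y (f i))"
  by (induction S rule: infinite_finite_induct) (auto simp: cinner_add_right)

lemma scaleC_sum_right: "a *\<^sub>C sum f S = (\<Sum>i\<in>S. a *\<^sub>C (f i::'a::complex_hilbert_space))"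
  by (induction S rule: infinite_finite_induct) (auto simp: scaleC_add_right)

lemma cinner_self: "cinner x x = of_real ((norm (x::'a::complex_hilbert_space))\<^sup>2)"
proof (rule complex_eqI)
  show "Re (cinner x x) = Re (of_real ((norm x)\<^sup>2))"
    by (simp add: inner_eq_Re_cinner [symmetric] power2_norm_eq_inner)
  show "Im (cinner x x) = Im (of_real ((norm x)\<^sup>2))"
    using arg_cong [OF cinner_commute [of x x], of Im] by simp
qed

lemma norm_scaleC: "norm (a *\<^sub>C (x::'a::complex_hilbert_space)) = cmod a * norm x"
proof -
  have "cinner (a *\<^sub>C x) (a *\<^sub>C x) = (a * cnj a) * cinner x x"
    by (simp add: cinner_scaleC_left cinner_scaleC_right mult_ac)
  then have "(of_real ((norm (a *\<^sub>C x))\<^sup>2) :: complex) = of_real ((cmod a)\<^sup>2 * (norm x)\<^sup>2)"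
    by (simp only: cinner_self flip: complex_norm_square) simp
  then have "(norm (a *\<^sub>C x))\<^sup>2 = (cmod a * norm x)\<^sup>2"
    unfolding of_real_eq_iff by (simp add: power_mult_distrib)
  then show ?thesis by (simp add: power2_eq_iff_nonneg)
qed

lemma norm_cinner_le: "cmod (cinner x y) \<le> norm x * norm (y::'a::complex_hilbert_space)"
proof (cases "cinner x y = 0")
  case False
  \<comment> \<open>The unimodular factor \<open>u\<close> rotates \<open>cinner x y\<close> onto
    the positive axis, which leaves the real Cauchy-Schwarz inequality for
    \<open>u *\<^sub>C x\<close> and \<open>y\<close>.\<close>
  define u where "u = cnj (sgn (cinner x y))"
  have "of_real (cmod (cinner x y)) = u * cinner x y"
    using False by (simp add: u_def sgn_eq field_simps flip: complex_norm_square power2_eq_square)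
  then have "cmod (cinner x y) = Re (cinner (u *\<^sub>C x) y)"
    by (metis Re_complex_of_real cinner_scaleC_left)
  also have "\<dots> \<le> norm (u *\<^sub>C x) * norm y"
    by (metis Cauchy_Schwarz_ineq2 abs_le_D1 inner_eq_Re_cinner)
  also have "norm (u *\<^sub>C x) = norm x"
    using False by (simp add: norm_scaleC u_def norm_sgn)
  finally show ?thesis .
qed auto

lemma cinner_ext:
  assumes "\<And>x. cinner x y = cinner x (z::'a::complex_hilbert_space)"
  shows "y = z"
  using assms by (metis inner_eq_Re_cinner vector_eq_ldot)

text \<open>The representing vector minimizes \<open>J x = inner x x - 2 * f x\<close>: a minimizing
  sequence is Cauchy by the parallelogram law, and stationarity of \<open>J\<close> at the limit
  \<open>z\<close> says \<open>f h = inner h z\<close>.\<close>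

lemma Riesz_representation:
  fixes f :: "'a::{real_inner,complete_space} \<Rightarrow> real"
  assumes f: "bounded_linear f"
  obtains y where "\<And>x. f x = inner x y"
proof -
  interpret f: bounded_linear f by fact
  obtain K where K: "K > 0" "\<And>x. \<bar>f x\<bar> \<le> norm x * K"
    using f.pos_bounded by auto
  define J where "J = (\<lambda>x. inner x x - 2 * f x)"
  have lb: "- (K\<^sup>2) \<le> J x" for x
  proof -
    have "0 \<le> (norm x - K)\<^sup>2" by simp
    then show ?thesis
      using K(2)[of x] by (simp add: J_def power2_eq_square algebra_simps flip: power2_norm_eq_inner)
  qed
  define d where "d = Inf (range J)"
  have bdd: "bdd_below (range J)" using lb by (auto intro!: bdd_belowI)
  have dle: "d \<le> J x" for x unfolding d_def using bdd by (simp add: cInf_lower)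
  have "\<exists>x. J x < d + 1 / real (Suc n)" for n
  proof -
    have "Inf (range J) < d + 1 / real (Suc n)" by (simp add: d_def)
    then show ?thesis using bdd by (subst (asm) cInf_less_iff) auto
  qed
  then obtain X where X: "\<And>n. J (X n) < d + 1 / real (Suc n)" by metis
  \<comment> \<open>In the combination with the midpoint the linear part of \<open>J\<close>
    cancels, and the parallelogram law remains.\<close>
  have par: "(norm (x - y))\<^sup>2 \<le> 2 * (J x - d) + 2 * (J y - d)" for x y
  proof -
    have "(norm (x - y))\<^sup>2 = 2 * J x + 2 * J y - 4 * J ((1/2) *\<^sub>R (x + y))"
      by (simp add: J_def f.scaleR f.add power2_norm_eq_inner inner_add inner_diff algebra_simps
          inner_commute)
    then show ?thesis using dle[of "(1/2) *\<^sub>R (x + y)"] by simp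
  qed
  have "Cauchy X"
  proof (rule metric_CauchyI)
    fix e :: real assume e: "e > 0"
    obtain N where N: "inverse (real (Suc N)) < e\<^sup>2 / 4" using e reals_Archimedean[of "e\<^sup>2/4"] by auto
    have small: "J (X n) - d < e\<^sup>2/4" if "n \<ge> N" for n
    proof -
      have "inverse (real (Suc n)) \<le> inverse (real (Suc N))" using that by (intro le_imp_inverse_le) auto
      then show ?thesis using N X[of n] by (simp add: inverse_eq_divide)
    qed
    show "\<exists>M. \<forall>m\<ge>M. \<forall>n\<ge>M. dist (X m) (X n) < e"
    proof (intro exI allI impI)
      fix m n assume "m \<ge> N" "n \<ge> N"
      then have "(norm (X m - X n))\<^sup>2 < e\<^sup>2"
        using small[of m] small[of n] par[of "X m" "X n"] by simp
      then show "dist (X m) (X n) < e" using e by (metis dist_norm less_eq_real_def power2_less_imp_less)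
    qed
  qed
  then obtain z where z: "X \<longlonglongrightarrow> z" using Cauchy_convergent convergent_def by blast
  have "(\<lambda>n. J (X n)) \<longlonglongrightarrow> J z" unfolding J_def by (intro tendsto_intros z f.tendsto)
  moreover have "(\<lambda>n. d + 1 / real (Suc n)) \<longlonglongrightarrow> d + 0"
    by (intro tendsto_intros LIMSEQ_Suc [OF lim_1_over_n])
  ultimately have "J z \<le> d + 0"
    by (rule LIMSEQ_le) (use X less_imp_le in blast)
  then have zle: "J z \<le> J x" for x using dle[of x] by simp
  have "f h = inner h z" for h
  proof (cases "h = 0")
    case False
    define r where "r = f h - inner h z"
    \<comment> \<open>This \<open>t\<close> minimizes \<open>J\<close> on the line through
      \<open>z\<close> in direction \<open>h\<close>; the minimum is
      \<open>J z - r * r / inner h h\<close>, so minimality of \<open>z\<close> forces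
      \<open>r = 0\<close>.\<close>
    define t where "t = r / inner h h"
    have hh: "inner h h > 0" using False by simp
    have "J (z + t *\<^sub>R h) = J z + t * t * inner h h - 2 * t * r"
      by (simp add: J_def f.add f.scaleR r_def inner_add inner_commute algebra_simps)
    then have "0 \<le> t * t * inner h h - 2 * t * r" using zle[of "z + t *\<^sub>R h"] by simp
    also have "\<dots> = - (r * r / inner h h)" using hh by (simp add: t_def field_simps)
    finally have "r * r / inner h h \<le> 0" by simp
    then have "r * r \<le> 0" using hh by (simp add: divide_le_0_iff)
    then show ?thesis by (metis r_def eq_iff_diff_eq_0 mult_eq_0_iff order_antisym zero_le_square)
  qed (simp add: f.zero)
  then show ?thesis using that by blast
qed

section \<open>Bounded operators and adjoints\<close>

lemma bounded_opI:
  fixes T :: "'a::complex_hilbert_space \<Rightarrow> 'a"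
  assumes "\<And>x y. T (x + y) = T x + T y" "\<And>a x. T (a *\<^sub>C x) = a *\<^sub>C T x"
    and "\<And>x. norm (T x) \<le> K * norm x"
  shows "bounded_op T"
  unfolding bounded_op_def
proof
  show "bounded_linear T"
    using assms by (intro bounded_linear_intro [where K = K]) (auto simp: scaleR_eq_scaleC mult.commute)
qed (use assms in blast)

lemma bounded_op_linear: "bounded_op T \<Longrightarrow> bounded_linear T"
  by (simp add: bounded_op_def)

lemma bounded_op_scaleC: "bounded_op T \<Longrightarrow> T (a *\<^sub>C x) = a *\<^sub>C T x"
  by (simp add: bounded_op_def)

lemma bounded_op_add: "bounded_op T \<Longrightarrow> T (x + y) = T x + T y"
  by (simp add: bounded_op_def bounded_linear.linear linear_add)

lemma bounded_op_diff: "bounded_op T \<Longrightarrow> T (x - y) = T x - T y"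
  by (simp add: bounded_op_def bounded_linear.linear linear_diff)

lemma bounded_op_zero: "bounded_op T \<Longrightarrow> T 0 = 0"
  by (simp add: bounded_op_def bounded_linear.linear linear_0)

lemma bounded_op_sum: "bounded_op T \<Longrightarrow> T (sum f S) = (\<Sum>i\<in>S. T (f i))"
  by (simp add: bounded_op_def bounded_linear.linear linear_sum)

lemma bounded_op_norm_le: "bounded_op T \<Longrightarrow> norm (T x) \<le> onorm T * norm x"
  by (simp add: bounded_op_def onorm)

lemma bounded_op_id [simp]: "bounded_op id"
  by (rule bounded_opI [where K = 1]) auto

lemma bounded_op_compose: "bounded_op S \<Longrightarrow> bounded_op T \<Longrightarrow> bounded_op (S \<circ> T)"
  unfolding bounded_op_def comp_def using bounded_linear_compose by auto

lemma bounded_op_funpow: "bounded_op T \<Longrightarrow> bounded_op (T ^^ n)"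
  by (induction n) (auto intro: bounded_op_compose)

lemma bounded_op_scaled:
  assumes T: "bounded_op T"
  shows "bounded_op (\<lambda>x. c *\<^sub>C T x)"
proof (rule bounded_opI)
  show "norm (c *\<^sub>C T x) \<le> (cmod c * onorm T) * norm x" for x
    unfolding norm_scaleC mult.assoc by (intro mult_left_mono bounded_op_norm_le T) auto
qed (auto simp: T bounded_op_add bounded_op_scaleC scaleC_add_right scaleC_scaleC mult.commute)

lemma bounded_op_minus:
  assumes "bounded_op S" "bounded_op T"
  shows "bounded_op (\<lambda>x. S x - T x)"
proof (rule bounded_opI [where K = "onorm S + onorm T"])
  fix x
  show "norm (S x - T x) \<le> (onorm S + onorm T) * norm x"
    using bounded_op_norm_le [OF assms(1), of x] bounded_op_norm_le [OF assms(2), of x]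
      norm_triangle_ineq4 [of "S x" "T x"]
    by (simp add: algebra_simps)
qed (auto simp: assms bounded_op_add bounded_op_scaleC scaleC_diff_right)

text \<open>Riesz yields an adjoint for the real inner product only. Imaginary parts become real
  parts after multiplication by \<open>-\<i>\<close>, which commutes with \<open>T\<close>.\<close>

lemma cinner_adj:
  fixes T :: "'a::complex_hilbert_space \<Rightarrow> 'a"
  assumes T: "bounded_op T"
  shows "cinner (T x) y = cinner x (adj T y)"
proof -
  have "\<exists>s. \<forall>x. inner (T x) y = inner x s" for y
  proof -
    have "bounded_linear (\<lambda>x. inner (T x) y)"
      using bounded_linear_compose [OF bounded_linear_inner_left bounded_op_linear [OF T]] .
    from Riesz_representation [OF this] show ?thesis by metis
  qed
  then obtain S where S: "\<And>x y. inner (T x) y = inner x (S y)" by metis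
  have "cinner (T x) y = cinner x (S y)" for x y
  proof (rule complex_eqI)
    show "Re (cinner (T x) y) = Re (cinner x (S y))" using S by (simp add: inner_eq_Re_cinner)
    have *: "Im (cinner u v) = Re (cinner ((-\<i>) *\<^sub>C u) v)" for u v :: 'a
      by (simp add: cinner_scaleC_left)
    show "Im (cinner (T x) y) = Im (cinner x (S y))"
      unfolding * bounded_op_scaleC [OF T, symmetric] by (metis S inner_eq_Re_cinner)
  qed
  then show ?thesis using adj_eqI by metis
qed

lemma cinner_adj': "bounded_op T \<Longrightarrow> cinner (adj T x) y = cinner x (T y)"
  by (metis cinner_adj cinner_commute)

lemma bounded_op_adj:
  assumes T: "bounded_op T"
  shows "bounded_op (adj T)"
proof (rule bounded_opI)
  show "adj T (x + y) = adj T x + adj T y" for x y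
    by (rule cinner_ext) (simp add: cinner_add_right flip: cinner_adj [OF T])
  show "adj T (a *\<^sub>C x) = a *\<^sub>C adj T x" for a x
    by (rule cinner_ext) (simp add: cinner_scaleC_right flip: cinner_adj [OF T])
  fix x
  have "(norm (adj T x))\<^sup>2 = cmod (cinner (T (adj T x)) x)"
    by (simp add: cinner_adj [OF T] cinner_self norm_power)
  also have "\<dots> \<le> norm (T (adj T x)) * norm x" by (rule norm_cinner_le)
  also have "\<dots> \<le> onorm T * norm (adj T x) * norm x"
    by (intro mult_right_mono bounded_op_norm_le T) auto
  finally have "norm (adj T x) * norm (adj T x) \<le> norm (adj T x) * (onorm T * norm x)"
    by (simp add: power2_eq_square mult_ac)
  then show "norm (adj T x) \<le> onorm T * norm x"
    using onorm_pos_le [OF bounded_op_linear [OF T]]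
    by (cases "adj T x = 0") (auto simp: mult_le_cancel_left)
qed

lemma adj_adj: "bounded_op T \<Longrightarrow> adj (adj T) = T"
  by (rule adj_eqI) (rule cinner_adj')

lemma adj_compose: "bounded_op S \<Longrightarrow> bounded_op T \<Longrightarrow> adj (S \<circ> T) = adj T \<circ> adj S"
  by (rule adj_eqI) (simp add: cinner_adj)

lemma invertible_op_bounded: "invertible_op T \<Longrightarrow> bounded_op T"
  by (simp add: invertible_op_def)

lemma invertible_op_inv:
  assumes "invertible_op T"
  shows "bij T" "bounded_op (inv T)" "inv T (T x) = x" "T (inv T x) = x"
proof -
  obtain S where S: "bounded_op S" "S \<circ> T = id" "T \<circ> S = id"
    using assms unfolding invertible_op_def by blast
  then show "bij T" using o_bij by blast
  have inv: "inv T = S" using S inv_unique_comp by blast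
  show "bounded_op (inv T)" "inv T (T x) = x" "T (inv T x) = x"
    unfolding inv using S by (auto simp: fun_eq_iff)
qed

lemma invertible_op_inv_op: "invertible_op T \<Longrightarrow> invertible_op (inv T)"
  unfolding invertible_op_def [of "inv T"]
  by (intro conjI exI [of _ T]) (auto simp: invertible_op_inv invertible_op_bounded fun_eq_iff)

text \<open>The lower bound gives both injectivity and the bound \<open>1/c\<close> for the
  set-theoretic inverse.\<close>

lemma invertible_opI_bounded_below:
  fixes T :: "'a::complex_hilbert_space \<Rightarrow> 'a"
  assumes T: "bounded_op T" and surj: "surj T" and c: "c > 0" and below: "\<And>x. c * norm x \<le> norm (T x)"
  shows "invertible_op T"
proof -
  have "inj T"
  proof (rule injI)
    fix x y assume "T x = T y"
    then have "c * norm (x - y) \<le> 0" using below [of "x - y"] by (simp add: bounded_op_diff [OF T])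
    then show "x = y" using c by (simp add: mult_le_0_iff)
  qed
  then have l: "inv T (T x) = x" and r: "T (inv T x) = x" for x
    using surj by (simp_all add: surj_f_inv_f)
  have "bounded_op (inv T)"
  proof (rule bounded_opI)
    show "inv T (x + y) = inv T x + inv T y" for x y
      by (metis l r bounded_op_add [OF T])
    show "inv T (a *\<^sub>C x) = a *\<^sub>C inv T x" for a x
      by (metis l r bounded_op_scaleC [OF T])
    show "norm (inv T x) \<le> 1/c * norm x" for x
      using below [of "inv T x"] c by (simp add: r field_simps)
  qed
  then show ?thesis unfolding invertible_op_def using T l r by (intro conjI exI) (auto simp: fun_eq_iff)
qed

lemma invertible_op_bounded_below:
  assumes "invertible_op T"
  obtains c where "c > 0" "\<And>x. c * norm x \<le> norm (T x)"
proof -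
  have b: "bounded_linear (inv T)" using assms invertible_op_inv bounded_op_linear by blast
  obtain K where K: "K > 0" "\<And>x. norm (inv T x) \<le> norm x * K"
    using bounded_linear.pos_bounded [OF b] by blast
  show thesis
  proof (rule that)
    show "1/K > 0" using K by simp
    show "1/K * norm x \<le> norm (T x)" for x
      using K(1) K(2)[of "T x"] by (simp add: invertible_op_inv [OF assms] field_simps)
  qed
qed

lemma invertible_op_compose:
  assumes "invertible_op S" "invertible_op T"
  shows "invertible_op (S \<circ> T)"
  unfolding invertible_op_def
  by (intro conjI exI [of _ "inv T \<circ> inv S"])
    (auto simp: fun_eq_iff assms invertible_op_inv invertible_op_bounded intro: bounded_op_compose)

lemma invertible_opI:
  assumes "bounded_op T" "bounded_op S" "\<And>x. S (T x) = x" "\<And>x. T (S x) = x"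
  shows "invertible_op T" "inv T = S"
proof -
  have "S \<circ> T = id" "T \<circ> S = id" using assms by auto
  then show "invertible_op T" "inv T = S"
    using assms inv_unique_comp by (auto simp: invertible_op_def)
qed

lemma invertible_op_adj:
  assumes T: "invertible_op T"
  shows "invertible_op (adj T)" "inv (adj T) = adj (inv T)"
proof -
  have b: "bounded_op T" "bounded_op (inv T)" using T invertible_op_inv invertible_op_bounded by auto
  have 1: "adj (inv T) (adj T x) = x" for x
    by (rule cinner_ext) (simp add: invertible_op_inv [OF T] flip: cinner_adj [OF b(1)] cinner_adj [OF b(2)])
  have 2: "adj T (adj (inv T) x) = x" for x
    by (rule cinner_ext) (simp add: invertible_op_inv [OF T] flip: cinner_adj [OF b(1)] cinner_adj [OF b(2)])
  show "invertible_op (adj T)" "inv (adj T) = adj (inv T)"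
    using invertible_opI [of "adj T" "adj (inv T)"] b bounded_op_adj 1 2 by blast+
qed

lemma unitary_norm:
  assumes "unitary U"
  shows "norm (U x) = norm x"
proof -
  have "cinner (U x) (U x) = cinner x (adj U (U x))"
    using assms by (simp add: unitary_def cinner_adj)
  also have "adj U (U x) = x" using assms by (simp add: unitary_def fun_eq_iff)
  finally have "(norm (U x))\<^sup>2 = (norm x)\<^sup>2" by (simp only: cinner_self of_real_eq_iff)
  then show ?thesis by simp
qed

lemma unitary_invertible:
  assumes "unitary U"
  shows "invertible_op U" "inv U = adj U" "unitary (adj U)"
proof -
  have U: "bounded_op U" "adj U (U x) = x" "U (adj U x) = x" for x
    using assms by (auto simp: unitary_def fun_eq_iff)
  then show "invertible_op U" "inv U = adj U"
    using invertible_opI [of U "adj U"] bounded_op_adj by blast+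
  show "unitary (adj U)" using assms by (simp add: unitary_def bounded_op_adj adj_adj)
qed

lemma unitaryI:
  fixes U :: "'a::complex_hilbert_space \<Rightarrow> 'a"
  assumes U: "bounded_op U" and surj: "surj U" and norm: "\<And>x. norm (U x) = norm x"
  shows "unitary U"
proof -
  \<comment> \<open>Polarization: preserving norms means preserving the real inner product, and this
    already determines the adjoint.\<close>
  have inner: "inner (U x) (U y) = inner x y" for x y
  proof -
    have "norm (U x + U y) = norm (x + y)" by (metis norm bounded_op_add [OF U])
    then show ?thesis
      using norm[of x] norm[of y] by (simp add: norm_eq inner_add inner_commute)
  qed
  have 1: "adj U (U x) = x" for x
  proof -
    have "inner y (adj U (U x)) = inner y x" for y
      by (metis inner inner_eq_Re_cinner cinner_adj [OF U])
    then show ?thesis using vector_eq_ldot by blast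
  qed
  have "U (adj U x) = x" for x using 1 surj by (metis surj_def)
  with 1 show ?thesis unfolding unitary_def by (auto simp: U)
qed

section \<open>Biisometric pairs\<close>

lemma power_bounded_bound:
  assumes "power_bounded T"
  obtains C where "C > 0" "\<And>n x. norm ((T ^^ n) x) \<le> C * norm x"
proof -
  obtain M where M: "\<And>n. onorm (T ^^ n) \<le> M"
    using assms by (auto simp: power_bounded_def bdd_above_def)
  have b: "bounded_op (T ^^ n)" for n using assms by (simp add: power_bounded_def bounded_op_funpow)
  show thesis
  proof (rule that)
    \<comment> \<open>The maximum with 1 keeps the constant positive even on the zero space.\<close>
    show "max M 1 > 0" by simp
    show "norm ((T ^^ n) x) \<le> max M 1 * norm x" for n x
      using M [of n]
      by (intro order_trans [OF bounded_op_norm_le [OF b]] mult_right_mono) (auto simp: max_def)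
  qed
qed

definition fwd_diff :: "(nat \<Rightarrow> complex) \<Rightarrow> nat \<Rightarrow> complex" where
  "fwd_diff s n = s (Suc n) - s n"

text \<open>Pascal's rule drives the induction. The coefficients are those of
  \<open>biisometric_pair\<close>, so that condition becomes the vanishing of an \<open>m\<close>-th
  difference.\<close>

lemma fwd_diff_funpow:
  "(fwd_diff ^^ m) s n = (\<Sum>j\<le>m. (-1) ^ j * of_nat (m choose j) * s (n + (m - j)))"
proof (induction m arbitrary: s n)
  case (Suc m)
  have "(\<Sum>j\<le>Suc m. (-1) ^ j * of_nat (Suc m choose j) * s (n + (Suc m - j)))
    = s (n + Suc m) + (\<Sum>j\<le>m. (-1) ^ Suc j * of_nat (Suc m choose Suc j) * s (n + (m - j)))"
    by (subst sum.atMost_Suc_shift) simp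
  also have "\<dots> = s (n + Suc m) + (\<Sum>j\<le>m. (-1) ^ Suc j * of_nat (m choose Suc j) * s (n + (m - j)))
      + (\<Sum>j\<le>m. (-1) ^ Suc j * of_nat (m choose j) * s (n + (m - j)))"
    unfolding add.assoc sum.distrib [symmetric]
    by (intro arg_cong2 [of _ _ _ _ "(+)"] refl sum.cong) (auto simp: algebra_simps)
  also have "s (n + Suc m) + (\<Sum>j\<le>m. (-1) ^ Suc j * of_nat (m choose Suc j) * s (n + (m - j)))
     = (\<Sum>j\<le>Suc m. (-1) ^ j * of_nat (m choose j) * s (n + (Suc m - j)))"
    by (subst sum.atMost_Suc_shift) simp
  also have "\<dots> = (\<Sum>j\<le>m. (-1) ^ j * of_nat (m choose j) * s (Suc n + (m - j)))"
    by (auto simp: Suc_diff_le intro!: sum.cong)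
  finally show ?case
    by (simp only: funpow_Suc_right comp_apply Suc.IH)
      (simp add: fwd_diff_def algebra_simps sum_subtractf sum_negf)
qed simp

text \<open>Otherwise the last nonvanishing difference would make the sequence grow linearly.\<close>

lemma fwd_diff_bounded:
  assumes "bounded (range s)" and "\<And>n. (fwd_diff ^^ Suc m) s n = 0"
  shows "s n = s 0"
  using assms
proof (induction m arbitrary: s n)
  case 0
  then show ?case by (induction n) (auto simp: fwd_diff_def)
next
  case (Suc m)
  obtain K where K: "\<And>n. cmod (s n) \<le> K" using Suc.prems(1) by (auto simp: bounded_iff)
  have bd: "bounded (range (fwd_diff s))"
  proof -
    have "cmod (fwd_diff s n) \<le> 2 * K" for n
      using norm_triangle_ineq4 [of "s (Suc n)" "s n"] K[of n] K[of "Suc n"] by (simp add: fwd_diff_def)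
    then show ?thesis by (auto simp: bounded_iff)
  qed
  have c: "fwd_diff s n = fwd_diff s 0" for n
    using Suc.prems(2) by (intro Suc.IH bd) (simp add: funpow_swap1)
  have lin: "s n = s 0 + of_nat n * fwd_diff s 0" for n
  proof (induction n)
    case (Suc n)
    moreover have "s (Suc n) = s n + fwd_diff s n" by (simp add: fwd_diff_def)
    ultimately show ?case by (simp add: c[of n] distrib_right)
  qed simp
  have "fwd_diff s 0 = 0"
  proof (rule ccontr)
    assume nz: "fwd_diff s 0 \<noteq> 0"
    then obtain n where n: "real n * cmod (fwd_diff s 0) > 2 * K"
      using reals_Archimedean3 [of "cmod (fwd_diff s 0)"] by auto
    have "real n * cmod (fwd_diff s 0) = cmod (s n - s 0)" using lin[of n] by (simp add: norm_mult)
    also have "\<dots> \<le> 2 * K" using norm_triangle_ineq4 [of "s n" "s 0"] K[of n] K[of 0] by simp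
    finally show False using n by simp
  qed
  then show ?case using lin by simp
qed

lemma adj_funpow:
  assumes A: "bounded_op A"
  shows "cinner ((adj A ^^ n) x) y = cinner x ((A ^^ n) y)"
  by (induction n arbitrary: x) (auto simp: cinner_adj' [OF A] funpow_swap1)

text \<open>Each coefficient sequence \<open>s n = cinner (P ((B ^^ n) x)) ((A ^^ n) y)\<close> is
  bounded, and its \<open>m\<close>-th difference at \<open>n\<close> is the biisometry sum at
  \<open>(B ^^ n) x\<close> paired with \<open>(A ^^ n) y\<close>, hence 0. So \<open>s\<close> is
  constant, and \<open>s 1 = s 0\<close> is the claim.\<close>

lemma biisometric_power_bounded:
  fixes A B P :: "'a::complex_hilbert_space \<Rightarrow> 'a"
  assumes A: "power_bounded A" and B: "power_bounded B" and m: "m > 0"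
    and P: "bounded_op P" and AB: "biisometric_pair m P A B"
  shows "adj A (P (B x)) = P x"
proof -
  have bA: "bounded_op A" using A by (simp add: power_bounded_def)
  have "cinner (adj A (P (B x)) - P x) y = 0" for y
  proof -
    define s where "s n = cinner (P ((B ^^ n) x)) ((A ^^ n) y)" for n
    obtain C where C: "C > 0" "\<And>n x. norm ((A ^^ n) x) \<le> C * norm x" using A power_bounded_bound by blast
    obtain D where D: "D > 0" "\<And>n x. norm ((B ^^ n) x) \<le> D * norm x" using B power_bounded_bound by blast
    have "bounded (range s)"
      unfolding bounded_iff
    proof (intro exI ballI, elim rangeE, simp)
      fix n
      have "cmod (s n) \<le> norm (P ((B ^^ n) x)) * norm ((A ^^ n) y)"
        unfolding s_def by (rule norm_cinner_le)
      also have "\<dots> \<le> (onorm P * (D * norm x)) * (C * norm y)"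
        using onorm_pos_le [OF bounded_op_linear [OF P]] C D
        by (intro mult_mono order_trans [OF bounded_op_norm_le [OF P]] mult_left_mono) auto
      finally show "cmod (s n) \<le> (onorm P * (D * norm x)) * (C * norm y)" .
    qed
    \<comment> \<open>The order is written as a successor to fit \<open>fwd_diff_bounded\<close>;
      here \<open>m > 0\<close> enters.\<close>
    moreover have "(fwd_diff ^^ Suc (m - 1)) s n = 0" for n
    proof -
      have "(fwd_diff ^^ m) s n = (\<Sum>j\<le>m. (-1) ^ j * of_nat (m choose j) * s (n + (m - j)))"
        by (rule fwd_diff_funpow)
      also have "\<dots> = cinner (\<Sum>j = 0..m. ((-1) ^ j * of_nat (m choose j)) *\<^sub>C
              ((adj A ^^ (m - j)) \<circ> P \<circ> (B ^^ (m - j))) ((B ^^ n) x)) ((A ^^ n) y)"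
        unfolding cinner_sum_left cinner_scaleC_left
        by (simp add: atMost_atLeast0 s_def adj_funpow [OF bA] flip: funpow_add comp_apply [of "A ^^ _" "A ^^ _"]
            comp_apply [of "B ^^ _" "B ^^ _"]) (simp add: add.commute)
      also have "\<dots> = 0" using AB by (simp add: biisometric_pair_def)
      finally show ?thesis using m by simp
    qed
    ultimately have "s 1 = s 0" by (rule fwd_diff_bounded)
    then show ?thesis by (simp add: s_def cinner_diff_left cinner_adj' [OF bA])
  qed
  then have "adj A (P (B x)) - P x = 0"
    by (metis cinner_self norm_eq_zero of_real_eq_0_iff power_eq_0_iff)
  then show ?thesis by simp
qed

text \<open>Taking adjoints on both sides exchanges \<open>A\<close> and \<open>B\<close>, because
  \<open>P\<close> is self-adjoint.\<close>

lemma biisometric_adj: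
  assumes A: "bounded_op A" and B: "bounded_op B" and P: "bounded_op P" "adj P = P"
    and AB: "\<And>x. adj A (P (B x)) = P x"
  shows "adj B (P (A x)) = P x"
proof (rule cinner_ext)
  fix y
  have "cinner y (adj B (P (A x))) = cinner (adj A (P (B y))) x"
    by (metis cinner_adj [OF B] cinner_adj' [OF A] cinner_adj [OF P(1)] P(2))
  then show "cinner y (adj B (P (A x))) = cinner y (P x)"
    by (metis AB cinner_adj [OF P(1)] P(2))
qed

text \<open>The operators \<open>inv P \<circ> adj A \<circ> P\<close> and \<open>inv P \<circ> adj B \<circ> P\<close> are left inverses of \<open>B\<close> and \<open>A\<close>, so the
  ranges of \<open>A\<close> and \<open>B\<close> are ranges of bounded idempotents \<open>E\<close> and \<open>F\<close>.  The vectors \<open>w\<close> and \<open>v\<close> are taken in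
  the ranges of \<open>1 - adj F\<close> and \<open>1 - adj E\<close>.\<close>

lemma biorthogonal_generators:
  fixes A B P :: "'a::complex_hilbert_space \<Rightarrow> 'a"
  assumes A: "bounded_op A" and B: "bounded_op B" and P: "invertible_op P" "adj P = P"
    and AB: "\<And>x. adj A (P (B x)) = P x"
    and ns: "\<not> surj B"
  obtains v w where "v \<noteq> 0" "adj A v = 0" "w \<noteq> 0" "adj B w = 0" "cinner (inv P w) v = 1"
proof -
  have bP: "bounded_op P" using P by (simp add: invertible_op_bounded)
  have biP: "bounded_op (inv P)" using P by (simp add: invertible_op_inv)
  have BA: "adj B (P (A x)) = P x" for x by (rule biisometric_adj [OF A B bP P(2) AB])
  note iP = invertible_op_inv(3,4) [OF P(1)]
  have iPP: "cinner (inv P x) y = cinner x (inv P y)" for x y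
    by (metis cinner_adj [OF bP] P(2) iP(2))
  have bA': "bounded_op (adj A)" and bB': "bounded_op (adj B)" using A B bounded_op_adj by auto
  \<comment> \<open>\<open>z\<close> is any vector outside the range of \<open>B\<close>; then
    \<open>u = z - F z\<close>, with \<open>F = B \<circ> inv P \<circ> adj A \<circ> P\<close>, is
    a nonzero vector in the kernel of \<open>F\<close>.\<close>
  obtain z where z: "z - B (inv P (adj A (P z))) \<noteq> 0" using ns by (metis eq_iff_diff_eq_0 surj_def)
  define u where "u = z - B (inv P (adj A (P z)))"
  define w where "w = u - P (A (inv P (adj B u)))"
  have Bw: "adj B w = 0" by (simp add: w_def bounded_op_diff [OF bB'] BA iP)
  \<comment> \<open>The left side is \<open>cinner u (adj F u) = cinner (F u) u\<close>. Hence
    \<open>w\<close> has inner product \<open>cinner u u\<close> with \<open>u\<close> and cannot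
    vanish.\<close>
  have "cinner u (P (A (inv P (adj B u)))) = 0"
  proof -
    have "cinner u (P (A (inv P (adj B u)))) = cinner (B (inv P (adj A (P u)))) u"
      by (metis cinner_adj [OF B] cinner_adj' [OF A] cinner_adj [OF bP] P(2) iPP)
    also have "adj A (P u) = 0"
      by (simp add: u_def bounded_op_diff [OF bP] bounded_op_diff [OF bA'] AB iP)
    finally show ?thesis by (simp add: bounded_op_zero biP B)
  qed
  then have "cinner u w = cinner u u" by (simp add: w_def cinner_diff_right)
  then have w0: "w \<noteq> 0" using z by (auto simp: u_def cinner_self)
  define y where "y = inv P w"
  have y0: "y \<noteq> 0" using w0 iP(2)[of w] bounded_op_zero [OF bP] by (auto simp: y_def)
  \<comment> \<open>The same argument with the other idempotent
    \<open>E = A \<circ> inv P \<circ> adj B \<circ> P\<close>: \<open>E y = 0\<close> since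
    \<open>adj B w = 0\<close>, so \<open>y\<close> is orthogonal to \<open>adj E y\<close>.\<close>
  define v0 where "v0 = y - P (B (inv P (adj A y)))"
  have Av0: "adj A v0 = 0" by (simp add: v0_def bounded_op_diff [OF bA'] AB iP)
  have "cinner y (P (B (inv P (adj A y)))) = cinner (A (inv P (adj B (P y)))) y"
    by (metis cinner_adj [OF A] cinner_adj' [OF B] cinner_adj [OF bP] P(2) iPP)
  also have "\<dots> = 0" by (simp add: y_def iP Bw bounded_op_zero biP A)
  finally have yv0: "cinner y v0 = cinner y y" by (simp add: v0_def cinner_diff_right)
  \<comment> \<open>Only \<open>v\<close> is rescaled; this is enough to normalize the
    pairing.\<close>
  define v where "v = (1 / cinner y y) *\<^sub>C v0"
  have yv: "cinner y v = 1"
    using y0 yv0 by (simp add: v_def cinner_scaleC_right cinner_self)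
  moreover have "adj A v = 0" by (simp add: v_def bounded_op_scaleC [OF bA'] Av0)
  moreover have "v \<noteq> 0" using yv by auto
  ultimately show thesis using that w0 Bw by (simp add: y_def)
qed

text \<open>Lowering both exponents by one leaves the pairing unchanged, so everything reduces to a
  zero exponent. There the kernel condition on \<open>v\<close> or \<open>w\<close> gives 0, except
  at \<open>k = n = 0\<close>, where the normalization gives 1.\<close>

lemma biorthogonal_generators_system:
  fixes A B P :: "'a::complex_hilbert_space \<Rightarrow> 'a"
  assumes A: "bounded_op A" and B: "bounded_op B" and P: "invertible_op P" "adj P = P"
    and AB: "\<And>x. adj A (P (B x)) = P x"
    and v: "adj A v = 0" and w: "adj B w = 0" and vw: "cinner (inv P w) v = 1"
  shows "biorthogonal_wrt P (\<lambda>n. (A ^^ n) (inv P w)) (\<lambda>n. (B ^^ n) (inv P v))"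
  unfolding biorthogonal_wrt_def cinner_wrt_def
proof (intro allI)
  fix k n
  have bP: "bounded_op P" using P by (simp add: invertible_op_bounded)
  have BA: "adj B (P (A x)) = P x" for x by (rule biisometric_adj [OF A B bP P(2) AB])
  note iP = invertible_op_inv(3,4) [OF P(1)]
  show "cinner (P ((A ^^ k) (inv P w))) ((B ^^ n) (inv P v)) = (if k = n then 1 else 0)"
  proof (induction k n rule: diff_induct)
    case (1 k)
    show ?case
    proof (cases k)
      case 0
      then show ?thesis using vw by (simp add: iP) (metis P(2) cinner_adj [OF bP] iP(2))
    next
      case (Suc j)
      have "cinner (P (A x)) (inv P v) = 0" for x
        by (metis P(2) cinner_adj [OF bP] cinner_adj [OF A] iP(2) v cinner_zero_right)
      then show ?thesis using Suc by simp
    qed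
  next
    case (2 n)
    have "cinner w (B x) = 0" for x
      by (metis cinner_adj' [OF B] w cinner_zero_left)
    then show ?case by (simp add: iP)
  next
    case (3 k n)
    have "cinner (P (A x)) (B y) = cinner (P x) y" for x y
      by (metis BA cinner_adj' [OF B])
    then show ?case using 3 by simp
  qed
qed

section \<open>Invariant forms and similarity to unitary operators\<close>

text \<open>Solving \<open>x - Y x = y\<close> is finding a fixed point of the contraction
  \<open>x \<mapsto> y + Y x\<close>.\<close>

lemma invertible_op_id_minus_contraction:
  fixes Y :: "'a::complex_hilbert_space \<Rightarrow> 'a"
  assumes Y: "bounded_op Y" and q: "0 \<le> q" "q < 1" and le: "\<And>x. norm (Y x) \<le> q * norm x"
  shows "invertible_op (\<lambda>x. x - Y x)"
proof (rule invertible_opI_bounded_below)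
  show "bounded_op (\<lambda>x. x - Y x)"
    using bounded_op_minus [OF bounded_op_id Y] by simp
  show "surj (\<lambda>x. x - Y x)"
    unfolding surj_def
  proof
    fix y
    have "\<exists>!x. y + Y x = x"
      using q le by (intro banach_fix_type) (auto simp: dist_norm simp flip: bounded_op_diff [OF Y])
    then show "\<exists>x. y = x - Y x" by (metis add_diff_cancel_right')
  qed
  show "1 - q > 0" using q by simp
  show "(1 - q) * norm x \<le> norm (x - Y x)" for x
    using le[of x] norm_triangle_ineq2 [of x "Y x"] by (simp add: algebra_simps)
qed

lemma bounded_linear_scaleC: "bounded_linear (\<lambda>x::'a::complex_hilbert_space. a *\<^sub>C x)"
  using bounded_op_linear [OF bounded_op_scaled [OF bounded_op_id]] by simp

text \<open>The square root of \<open>1 - T\<close> for a contraction \<open>T\<close> is \<open>1 - Y\<close>, where \<open>Y\<close> is the fixed point of the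
  contraction \<open>Y \<mapsto> (T + Y\<^sup>2) / 2\<close>.\<close>

lemma coercive_op_sqrt:
  fixes R :: "'a::complex_hilbert_space \<Rightarrow> 'a"
  assumes R: "bounded_op R" and sym: "\<And>x y. inner (R x) y = inner x (R y)"
    and a: "a > 0" and coercive: "\<And>x. a * (norm x)\<^sup>2 \<le> inner (R x) x"
  obtains Q where "invertible_op Q" "\<And>x. (norm (Q x))\<^sup>2 = inner (R x) x"
proof -
  obtain K where K: "K > 0" "\<And>x. norm (R x) \<le> norm x * K"
    using bounded_linear.pos_bounded [OF bounded_op_linear [OF R]] by blast
  define M where "M = max K a"
  have M: "M > 0" "a \<le> M" "norm (R x) \<le> M * norm x" for x
    using K(1) K(2)[of x] mult_right_mono [of K M "norm x"] by (auto simp: M_def mult.commute)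
  \<comment> \<open>This \<open>k\<close> minimizes the bound
    \<open>1 - 2 * a / k + (M / k)\<^sup>2\<close> for the squared norm of \<open>1 - R / k\<close>;
    the minimum is \<open>1 - (a / M)\<^sup>2\<close>. Having \<open>a\<close> in the maximum
    \<open>M\<close> keeps it nonnegative.\<close>
  define k where "k = M\<^sup>2 / a"
  have k: "k > 0" using M a by (simp add: k_def)
  define q where "q = sqrt (1 - (a / M)\<^sup>2)"
  have aM: "0 < a / M" "a / M \<le> 1" using M a by auto
  then have aM2: "0 < (a / M)\<^sup>2" "(a / M)\<^sup>2 \<le> 1" using power_le_one [of "a/M" 2] by auto
  then have q: "0 \<le> q" "q < 1" "q\<^sup>2 = 1 - (a / M)\<^sup>2" by (auto simp: q_def)
  define t where "t = (\<lambda>x. x - (of_real (1/k)) *\<^sub>C R x)"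
  have bt: "bounded_op t"
    unfolding t_def using bounded_op_minus [OF bounded_op_id bounded_op_scaled [OF R]] by simp
  have t_eq: "t x = x - (1/k) *\<^sub>R R x" for x by (simp add: t_def scaleR_eq_scaleC)
  have t_le: "norm (t x) \<le> q * norm x" for x
  proof (rule power2_le_imp_le)
    have "(norm (t x))\<^sup>2 = (norm x)\<^sup>2 - 2 / k * inner (R x) x + (1/k)\<^sup>2 * (norm (R x))\<^sup>2"
      unfolding t_eq power2_norm_eq_inner
      by (simp add: inner_diff inner_commute power2_eq_square field_simps)
    also have "\<dots> \<le> (norm x)\<^sup>2 - 2 / k * (a * (norm x)\<^sup>2) + (1/k)\<^sup>2 * (M * norm x)\<^sup>2"
      using M(3)[of x] coercive[of x] k
      by (intro add_mono diff_mono mult_left_mono power_mono) auto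
    also have "\<dots> = (norm x)\<^sup>2 * (1 - 2 * (a / k) + (M / k)\<^sup>2)"
      by (simp add: algebra_simps power_divide)
    also have "1 - 2 * (a / k) + (M / k)\<^sup>2 = 1 - (a / M)\<^sup>2"
      using a M by (simp add: k_def field_simps power2_eq_square)
    finally show "(norm (t x))\<^sup>2 \<le> (q * norm x)\<^sup>2" by (simp add: q power_mult_distrib mult.commute)
  qed (use q in auto)
  have t_sym: "inner (t x) y = inner x (t y)" for x y
    by (simp add: t_eq inner_diff sym)
  define T where "T = Blinfun t"
  have T: "blinfun_apply T = t"
    unfolding T_def by (rule bounded_linear_Blinfun_apply) (rule bounded_op_linear [OF bt])
  have nT: "norm T \<le> q" using t_le q by (intro norm_blinfun_bound) (auto simp: T)
  \<comment> \<open>The fixed point is sought among real-linear maps. Symmetry and complex linearity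
    are closed conditions preserved by \<open>f\<close>, so placing them in \<open>S\<close> hands
    them to the fixed point.\<close>
  define S :: "('a \<Rightarrow>\<^sub>L 'a) set" where "S = {Y. norm Y \<le> q \<and>
     (\<forall>x y. inner (blinfun_apply Y x) y = inner x (blinfun_apply Y y)) \<and>
     (\<forall>b x. blinfun_apply Y (b *\<^sub>C x) = b *\<^sub>C blinfun_apply Y x)}"
  define f where "f Y = (1/2) *\<^sub>R (T + (Y o\<^sub>L Y))" for Y :: "'a \<Rightarrow>\<^sub>L 'a"
  have "closed S"
  proof -
    have [continuous_intros]: "continuous_on UNIV (\<lambda>Y::'a \<Rightarrow>\<^sub>L 'a. b *\<^sub>C blinfun_apply Y x)" for b x
      by (rule bounded_linear.continuous_on [OF bounded_linear_scaleC]) (intro continuous_intros)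
    show ?thesis unfolding S_def
      by (intro closed_Collect_conj closed_Collect_all closed_Collect_le closed_Collect_eq continuous_intros)
  qed
  then have 1: "complete S" by (simp add: complete_eq_closed)
  have 2: "S \<noteq> {}"
    using q by (auto simp: S_def intro!: exI [of _ 0])
  have 3: "f ` S \<subseteq> S"
  proof clarify
    fix Y assume Y: "Y \<in> S"
    then have nY: "norm Y \<le> q" by (simp add: S_def)
    have "norm (Y o\<^sub>L Y) \<le> q * q"
      using norm_blinfun_compose [of Y Y] mult_mono [OF nY nY] q by auto
    also have "q * q \<le> q" using q mult_left_le [of q q] by auto
    finally have "norm (T + (Y o\<^sub>L Y)) \<le> 2 * q" using nT norm_triangle_ineq [of T "Y o\<^sub>L Y"] by simp
    moreover have "t (b *\<^sub>C x) = b *\<^sub>C t x" for b x using bt by (rule bounded_op_scaleC)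
    ultimately show "f Y \<in> S"
      using Y
      by (simp add: S_def f_def T blinfun.add_left blinfun.scaleR_left inner_add t_sym scaleC_add_right
          linear_scale [OF bounded_linear.linear [OF bounded_linear_scaleC]])
  qed
  have 4: "dist (f X) (f Y) \<le> q * dist X Y" if "X \<in> S" "Y \<in> S" for X Y
  proof -
    have "f X - f Y = (1/2) *\<^sub>R ((X o\<^sub>L (X - Y)) + ((X - Y) o\<^sub>L Y))"
      by (rule blinfun_eqI) (simp add: f_def blinfun.bilinear_simps algebra_simps)
    moreover have "norm (X o\<^sub>L (X - Y)) \<le> q * norm (X - Y)"
      using that mult_right_mono [of "norm X" q "norm (X - Y)"]
      by (intro order_trans [OF norm_blinfun_compose]) (simp add: S_def)
    moreover have "norm ((X - Y) o\<^sub>L Y) \<le> norm (X - Y) * q"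
      using that mult_left_mono [of "norm Y" q "norm (X - Y)"]
      by (intro order_trans [OF norm_blinfun_compose]) (simp add: S_def)
    ultimately show ?thesis
      using norm_triangle_ineq [of "X o\<^sub>L (X - Y)" "(X - Y) o\<^sub>L Y"]
      by (simp add: dist_norm mult.commute)
  qed
  obtain Y where Y: "Y \<in> S" "f Y = Y" using Banach_fix [OF 1 2 q(1,2) 3 4] by blast
  define y where "y = blinfun_apply Y"
  have y_sym: "inner (y x) z = inner x (y z)" for x z using Y by (simp add: S_def y_def)
  have by_op: "bounded_op y"
    using Y by (auto simp: bounded_op_def y_def S_def intro: blinfun.bounded_linear_right)
  have yq: "norm (y x) \<le> q * norm x" for x
    using norm_blinfun [of Y x] Y mult_right_mono [of "norm Y" q "norm x"] by (auto simp: S_def y_def)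
  have "2 *\<^sub>R y x = t x + y (y x)" for x
  proof -
    have "y x = (1/2) *\<^sub>R (t x + y (y x))"
      using arg_cong [OF Y(2), of "\<lambda>Z. blinfun_apply Z x"]
      by (simp add: f_def blinfun.bilinear_simps T y_def)
    then show ?thesis by (metis pth_1 scaleR_scaleR scaleR_one nonzero_mult_div_cancel_left times_divide_eq_right
          mult.right_neutral zero_neq_numeral)
  qed
  \<comment> \<open>The fixed point equation says \<open>(1 - y)\<^sup>2 = 1 - t = R / k\<close>;
    the factor \<open>sqrt k\<close> in \<open>Q\<close> then restores \<open>R\<close>.\<close>
  then have sq: "x - 2 *\<^sub>R y x + y (y x) = (1/k) *\<^sub>R R x" for x by (simp add: t_eq algebra_simps)
  define Q where "Q = (\<lambda>x. of_real (sqrt k) *\<^sub>C (x - y x))"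
  have inv1: "invertible_op (\<lambda>x. x - y x)"
    by (rule invertible_op_id_minus_contraction [OF by_op q(1,2) yq])
  obtain c where c: "c > 0" "\<And>x. c * norm x \<le> norm (x - y x)"
    using invertible_op_bounded_below [OF inv1] by blast
  have "invertible_op Q"
  proof (rule invertible_opI_bounded_below)
    show "bounded_op Q" unfolding Q_def by (intro bounded_op_scaled invertible_op_bounded inv1)
    show "sqrt k * c > 0" using k c by simp
    show "sqrt k * c * norm x \<le> norm (Q x)" for x
      using c(2)[of x] k by (simp add: Q_def norm_scaleC mult.assoc)
    show "surj Q"
      unfolding surj_def
    proof
      fix z
      obtain x where "(1 / of_real (sqrt k)) *\<^sub>C z = x - y x"
        using invertible_op_inv(1) [OF inv1] unfolding bij_def surj_def by blast
      then have "Q x = (of_real (sqrt k) * (1 / of_real (sqrt k))) *\<^sub>C z"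
        unfolding Q_def scaleC_scaleC [symmetric] by simp
      then show "\<exists>x. z = Q x" using k by auto
    qed
  qed
  moreover have "(norm (Q x))\<^sup>2 = inner (R x) x" for x
  proof -
    have "(norm (Q x))\<^sup>2 = k * inner (x - y x) (x - y x)"
      using k by (simp add: Q_def norm_scaleC power_mult_distrib power2_norm_eq_inner)
    also have "inner (x - y x) (x - y x) = inner (x - 2 *\<^sub>R y x + y (y x)) x"
      by (simp add: inner_diff inner_add y_sym inner_commute)
    also have "\<dots> = 1 / k * inner (R x) x" by (simp add: sq)
    finally show ?thesis using k by simp
  qed
  ultimately show thesis using that by blast
qed

text \<open>A pointwise cluster point of the Cesaro means of the forms \<open>(x, y) \<mapsto> \<langle>A\<^sup>k x, A\<^sup>k y\<rangle>\<close>, given by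
  Tychonoff's theorem, plays the role of a Banach limit.\<close>

lemma power_bounded_invariant_form:
  fixes A :: "'a::complex_hilbert_space \<Rightarrow> 'a"
  assumes A: "bounded_op A"
    and C: "C > 0" "\<And>n x. norm ((A ^^ n) x) \<le> C * norm x"
    and c: "c > 0" "\<And>n x. c * norm x \<le> norm ((A ^^ n) x)"
  obtains f :: "'a \<times> 'a \<Rightarrow> real" where
    "\<And>x x' y. f (x + x', y) = f (x, y) + f (x', y)"
    "\<And>x y. f (x, y) = f (y, x)"
    "\<And>a x y. f (a *\<^sub>C x, y) = f (x, cnj a *\<^sub>C y)"
    "\<And>x y. f (A x, A y) = f (x, y)"
    "\<And>r x y. f (r *\<^sub>R x, y) = r * f (x, y)"
    "\<And>x y. \<bar>f (x, y)\<bar> \<le> C\<^sup>2 * norm x * norm y"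
    "\<And>x. c\<^sup>2 * (norm x)\<^sup>2 \<le> f (x, x)"
proof -
  define g where "g k = (\<lambda>(x, y). inner ((A ^^ k) x) ((A ^^ k) y))" for k
  define F where "F n p = (\<Sum>k\<le>n. g k p) / real (Suc n)" for n p
  define B where "B = (\<lambda>(x::'a, y::'a). C\<^sup>2 * norm x * norm y)"
  have g_le: "\<bar>g k p\<bar> \<le> B p" for k p
  proof (cases p)
    case (Pair x y)
    have "\<bar>g k p\<bar> \<le> norm ((A ^^ k) x) * norm ((A ^^ k) y)"
      by (simp add: Pair g_def Cauchy_Schwarz_ineq2)
    also have "\<dots> \<le> (C * norm x) * (C * norm y)" using C by (intro mult_mono) auto
    finally show ?thesis by (simp add: Pair B_def power2_eq_square mult_ac)
  qed
  have F_le: "\<bar>F n p\<bar> \<le> B p" for n p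
  proof -
    have "\<bar>\<Sum>k\<le>n. g k p\<bar> \<le> (\<Sum>k\<le>n. B p)" by (intro order_trans [OF sum_abs] sum_mono g_le)
    then show ?thesis by (simp add: F_def field_simps)
  qed
  have F_ge: "c\<^sup>2 * (norm x)\<^sup>2 \<le> F n (x, x)" for n x
  proof -
    have "(\<Sum>k\<le>n. c\<^sup>2 * (norm x)\<^sup>2) \<le> (\<Sum>k\<le>n. g k (x, x))"
    proof (rule sum_mono)
      fix k
      have "(c * norm x)\<^sup>2 \<le> (norm ((A ^^ k) x))\<^sup>2" using c by (intro power_mono) auto
      then show "c\<^sup>2 * (norm x)\<^sup>2 \<le> g k (x, x)" by (simp add: g_def power_mult_distrib power2_norm_eq_inner)
    qed
    then show ?thesis by (simp add: F_def field_simps)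
  qed
  \<comment> \<open>The difference of the two means telescopes to two boundary terms divided by
    \<open>n + 1\<close>.\<close>
  have F_inv: "(\<lambda>n. F n (A x, A y) - F n (x, y)) \<longlonglongrightarrow> 0" for x y
  proof (rule Lim_null_comparison [OF always_eventually, OF allI])
    fix n
    have "F n (A x, A y) - F n (x, y) = (\<Sum>k\<le>n. g (Suc k) (x, y) - g k (x, y)) / real (Suc n)"
      by (simp add: F_def g_def funpow_swap1 diff_divide_distrib sum_subtractf)
    also have "(\<Sum>k\<le>n. g (Suc k) (x, y) - g k (x, y)) = g (Suc n) (x, y) - g 0 (x, y)"
      by (induction n) simp_all
    finally have "F n (A x, A y) - F n (x, y) = (g (Suc n) (x, y) - g 0 (x, y)) / real (Suc n)" .
    moreover have "\<bar>g (Suc n) (x, y) - g 0 (x, y)\<bar> \<le> 2 * B (x, y)"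
      using g_le[of "Suc n" "(x, y)"] g_le[of 0 "(x, y)"] by linarith
    ultimately show "norm (F n (A x, A y) - F n (x, y)) \<le> 2 * B (x, y) * (1 / real (Suc n))"
      by (simp add: abs_divide divide_right_mono del: of_nat_Suc)
  next
    have "(\<lambda>n. 2 * B (x, y) * (1 / real (Suc n))) \<longlonglongrightarrow> 2 * B (x, y) * 0"
      by (intro tendsto_intros LIMSEQ_Suc [OF lim_1_over_n])
    then show "(\<lambda>n. 2 * B (x, y) * (1 / real (Suc n))) \<longlonglongrightarrow> 0" by simp
  qed
  have "compactin (product_topology (\<lambda>p. euclidean) UNIV) (PiE UNIV (\<lambda>p. {- B p..B p}))"
    by (simp add: compactin_PiE)
  then have cpt: "compact (PiE UNIV (\<lambda>p. {- B p..B p}))"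
    unfolding euclidean_product_topology by simp
  have ev: "eventually (\<lambda>h. h \<in> PiE UNIV (\<lambda>p. {- B p..B p})) (filtermap F sequentially)"
  proof -
    have "F n p \<in> {- B p..B p}" for n p using F_le[of n p] by (simp add: abs_le_iff)
    then show ?thesis by (simp only: eventually_filtermap PiE_UNIV_domain) simp
  qed
  obtain f where f: "inf (nhds f) (filtermap F sequentially) \<noteq> bot"
    using cpt [unfolded compact_filter, rule_format, OF _ ev] by (auto simp: filtermap_bot_iff)
  \<comment> \<open>\<open>G\<close> refines both the neighbourhoods of \<open>f\<close> and the
    tails of the sequence \<open>F\<close>: evaluations converge to those of \<open>f\<close> along
    \<open>G\<close>, so relations that hold for \<open>F n\<close> exactly or in the limit pass to
    \<open>f\<close>.\<close>
  define G where "G = inf (nhds f) (filtermap F sequentially)"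
  have G: "G \<noteq> bot" using f by (simp add: G_def)
  have lim [tendsto_intros]: "((\<lambda>h. h p) \<longlongrightarrow> f p) G" for p
  proof -
    have "((\<lambda>h. h p) \<longlongrightarrow> f p) (at f)"
      using continuous_on_product_coordinates [of p] unfolding continuous_on_def by blast
    then have "((\<lambda>h. h p) \<longlongrightarrow> f p) (nhds f)"
      using tendsto_at_iff_tendsto_nhds [of "\<lambda>h. h p" f] by simp
    then show ?thesis unfolding G_def by (rule tendsto_mono [OF inf_le1])
  qed
  have zero: "\<Phi> f = 0" if "(\<Phi> \<longlongrightarrow> \<Phi> f) G" "(\<lambda>n. \<Phi> (F n)) \<longlonglongrightarrow> 0" for \<Phi> :: "('a \<times> 'a \<Rightarrow> real) \<Rightarrow> real"
  proof -
    have "(\<Phi> \<longlongrightarrow> 0) (filtermap F sequentially)" using that(2) by (simp add: filterlim_filtermap)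
    then have "(\<Phi> \<longlongrightarrow> 0) G" unfolding G_def by (rule tendsto_mono [OF inf_le2])
    then show ?thesis using that(1) G tendsto_unique by blast
  qed
  have evG: "eventually R G" if "\<And>n. R (F n)" for R
    using that unfolding G_def by (intro filter_leD [OF inf_le2]) (auto simp: eventually_filtermap)
  have Fdef: "F n (x, y) = (\<Sum>k\<le>n. inner ((A ^^ k) x) ((A ^^ k) y)) / real (Suc n)" for n x y
    by (simp add: F_def g_def)
  note Ak = bounded_op_funpow [OF A]
  show thesis
  proof (rule that)
    fix x x' y :: 'a and a :: complex and r :: real
    have "f (x + x', y) - (f (x, y) + f (x', y)) = 0"
    proof (rule zero [of "\<lambda>h. h (x + x', y) - (h (x, y) + h (x', y))"])
      have "F n (x + x', y) - (F n (x, y) + F n (x', y)) = 0" for n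
        by (simp add: Fdef bounded_op_add [OF Ak] inner_add sum.distrib add_divide_distrib)
      then show "(\<lambda>n. F n (x + x', y) - (F n (x, y) + F n (x', y))) \<longlonglongrightarrow> 0" by simp
    qed (intro tendsto_intros)
    then show "f (x + x', y) = f (x, y) + f (x', y)" by simp
    have "f (x, y) - f (y, x) = 0"
      by (rule zero [of "\<lambda>h. h (x, y) - h (y, x)"]) (intro tendsto_intros, simp add: Fdef inner_commute)
    then show "f (x, y) = f (y, x)" by simp
    have "f (a *\<^sub>C x, y) - f (x, cnj a *\<^sub>C y) = 0"
      by (rule zero [of "\<lambda>h. h (a *\<^sub>C x, y) - h (x, cnj a *\<^sub>C y)"])
        (intro tendsto_intros, simp add: Fdef bounded_op_scaleC [OF Ak] inner_eq_Re_cinner cinner_scaleC_left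
          cinner_scaleC_right)
    then show "f (a *\<^sub>C x, y) = f (x, cnj a *\<^sub>C y)" by simp
    have "f (A x, A y) - f (x, y) = 0"
      by (rule zero [of "\<lambda>h. h (A x, A y) - h (x, y)"]) (intro tendsto_intros, rule F_inv)
    then show "f (A x, A y) = f (x, y)" by simp
    have "f (r *\<^sub>R x, y) - r * f (x, y) = 0"
      by (rule zero [of "\<lambda>h. h (r *\<^sub>R x, y) - r * h (x, y)"])
        (intro tendsto_intros, simp add: Fdef bounded_op_scaleC [OF Ak] scaleR_eq_scaleC inner_eq_Re_cinner
          cinner_scaleC_left sum_distrib_left)
    then show "f (r *\<^sub>R x, y) = r * f (x, y)" by simp
    have "\<bar>f (x, y)\<bar> \<le> B (x, y)"
      by (rule tendsto_upperbound [OF _ evG G, of "\<lambda>h. \<bar>h (x, y)\<bar>"]) (intro tendsto_intros, rule F_le)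
    then show "\<bar>f (x, y)\<bar> \<le> C\<^sup>2 * norm x * norm y" by (simp add: B_def)
    show "c\<^sup>2 * (norm x)\<^sup>2 \<le> f (x, x)"
      by (rule tendsto_lowerbound [OF _ evG G, of "\<lambda>h. h (x, x)"]) (intro tendsto_intros, rule F_ge)
  qed
qed

text \<open>The invariant form is represented by a coercive \<open>R\<close>, and \<open>Q\<close>
  turns it into a norm: \<open>norm (Q x) ^ 2 = f (x, x)\<close>. Invariance under \<open>A\<close>
  makes \<open>Q \<circ> A \<circ> inv Q\<close> isometric.\<close>

theorem Sz_Nagy_similarity:
  fixes A :: "'a::complex_hilbert_space \<Rightarrow> 'a"
  assumes A: "invertible_op A"
    and C: "C > 0" "\<And>n x. norm ((A ^^ n) x) \<le> C * norm x"
    and c: "c > 0" "\<And>n x. c * norm x \<le> norm ((A ^^ n) x)"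
  obtains U where "unitary U" "similar_op A U"
proof -
  have bA: "bounded_op A" using A by (rule invertible_op_bounded)
  obtain f :: "'a \<times> 'a \<Rightarrow> real" where f:
    "\<And>x x' y. f (x + x', y) = f (x, y) + f (x', y)"
    "\<And>x y. f (x, y) = f (y, x)"
    "\<And>a x y. f (a *\<^sub>C x, y) = f (x, cnj a *\<^sub>C y)"
    "\<And>x y. f (A x, A y) = f (x, y)"
    "\<And>r x y. f (r *\<^sub>R x, y) = r * f (x, y)"
    "\<And>x y. \<bar>f (x, y)\<bar> \<le> C\<^sup>2 * norm x * norm y"
    "\<And>x. c\<^sup>2 * (norm x)\<^sup>2 \<le> f (x, x)"
    using power_bounded_invariant_form [OF bA C c] by blast
  have "\<exists>z. \<forall>x. f (x, y) = inner x z" for y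
  proof -
    have "bounded_linear (\<lambda>x. f (x, y))"
      by (rule bounded_linear_intro [where K = "C\<^sup>2 * norm y"]) (use f in \<open>auto simp: mult_ac\<close>)
    from Riesz_representation [OF this] show ?thesis by metis
  qed
  then obtain R where R: "\<And>x y. f (x, y) = inner x (R y)" by metis
  have sym: "inner (R x) y = inner x (R y)" for x y by (metis R f(2) inner_commute)
  have ext: "u = v" if "\<And>x. inner x u = inner x v" for u v :: 'a using that vector_eq_ldot by blast
  have bR: "bounded_op R"
  proof (rule bounded_opI)
    show "R (x + y) = R x + R y" for x y
      by (rule ext) (metis R f(1) f(2) inner_add_right)
    show "R (a *\<^sub>C x) = a *\<^sub>C R x" for a x
    proof (rule ext)
      fix y
      have "inner y (R (a *\<^sub>C x)) = f (cnj a *\<^sub>C y, x)" by (simp add: R [symmetric] f(3))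
      also have "\<dots> = inner y (a *\<^sub>C R x)"
        by (simp add: R inner_eq_Re_cinner cinner_scaleC_left cinner_scaleC_right)
      finally show "inner y (R (a *\<^sub>C x)) = inner y (a *\<^sub>C R x)" .
    qed
    fix x
    have "norm (R x) * norm (R x) = f (R x, x)" by (simp add: R flip: power2_norm_eq_inner power2_eq_square)
    also have "\<dots> \<le> norm (R x) * (C\<^sup>2 * norm x)" using f(6)[of "R x" x] by (simp add: mult_ac)
    finally show "norm (R x) \<le> C\<^sup>2 * norm x"
      by (cases "R x = 0") (auto simp: mult_le_cancel_left)
  qed
  obtain Q where Q: "invertible_op Q" "\<And>x. (norm (Q x))\<^sup>2 = inner (R x) x"
    using coercive_op_sqrt [OF bR sym, of "c\<^sup>2"] c(1) f(7) by (metis R sym zero_less_power)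
  note iQ = invertible_op_inv [OF Q(1)]
  have QA: "norm (Q (A x)) = norm (Q x)" for x
  proof -
    have "(norm (Q (A x)))\<^sup>2 = (norm (Q x))\<^sup>2" unfolding Q(2) by (metis R f(4) sym)
    then show ?thesis by simp
  qed
  define U where "U = Q \<circ> A \<circ> inv Q"
  have "invertible_op U"
    unfolding U_def by (intro invertible_op_compose Q A invertible_op_inv_op)
  then have "unitary U"
    using invertible_op_inv(1) [of U] by (intro unitaryI invertible_op_bounded)
      (auto simp: bij_def U_def QA iQ)
  moreover have "similar_op A U"
    unfolding similar_op_def by (intro exI [of _ Q] conjI Q) (auto simp: U_def iQ fun_eq_iff)
  ultimately show thesis using that by blast
qed

section \<open>Operators with numerical radius one\<close>

text \<open>The summands are the powers of a quotient \<open>z\<close> of two \<open>N\<close>-th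
  roots of unity, so for \<open>z \<noteq> 1\<close> the geometric sum vanishes.\<close>

lemma sum_roots_of_unity_mult_cnj:
  assumes "k < N" "l < N"
  shows "(\<Sum>j<N. cis (2 * pi * real j / real N) ^ k * cnj (cis (2 * pi * real j / real N) ^ l)) =
    (if k = l then of_nat N else 0)"
proof -
  define z where "z = cis (2 * pi * real k / real N) * cnj (cis (2 * pi * real l / real N))"
  have pow: "cis (2 * pi * real j / real N) ^ k * cnj (cis (2 * pi * real j / real N) ^ l) = z ^ j" for j
    unfolding z_def complex_cnj_power cis_cnj Complex.DeMoivre cis_mult
    by (rule arg_cong [of _ _ cis]) (simp add: field_simps)
  show ?thesis
  proof (cases "k = l")
    case True
    then have "z = 1" by (simp add: z_def cis_cnj cis_mult)
    then show ?thesis unfolding pow using True by simp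
  next
    case False
    have "cis (2 * pi * real k / real N) \<noteq> cis (2 * pi * real l / real N)"
      using bij_betw_imp_inj_on [OF Complex.bij_betw_roots_unity [of N]] assms False
      by (auto dest: inj_onD)
    moreover have "z * cis (2 * pi * real l / real N) = cis (2 * pi * real k / real N)"
      unfolding z_def cis_cnj cis_mult by simp
    ultimately have "z \<noteq> 1" by auto
    moreover have "cis (2 * pi * real k / real N) ^ N = 1" for k
      using assms cis_multiple_2pi [of "real k"] by (simp add: Complex.DeMoivre)
    then have "z ^ N = 1"
      unfolding z_def power_mult_distrib complex_cnj_power [symmetric] by simp
    ultimately show ?thesis unfolding pow using False by (simp add: geometric_sum)
  qed
qed

text \<open>A discrete substitute for integrating over the unit circle: by orthogonality of the
  characters only the diagonal terms survive.\<close>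

lemma roots_of_unity_Parseval:
  fixes a b :: "nat \<Rightarrow> 'a::complex_hilbert_space"
  defines "\<omega> \<equiv> \<lambda>N j. cis (2 * pi * real j / real N)"
  shows "(\<Sum>j<N. cinner (\<Sum>k<N. \<omega> N j ^ k *\<^sub>C a k) (\<Sum>k<N. \<omega> N j ^ k *\<^sub>C b k))
    = of_nat N * (\<Sum>k<N. cinner (a k) (b k))"
proof -
  have "(\<Sum>j<N. cinner (\<Sum>k<N. \<omega> N j ^ k *\<^sub>C a k) (\<Sum>k<N. \<omega> N j ^ k *\<^sub>C b k))
    = (\<Sum>j<N. \<Sum>k<N. \<Sum>l<N. (\<omega> N j ^ k * cnj (\<omega> N j ^ l)) * cinner (a k) (b l))"
    unfolding cinner_sum_left unfolding cinner_sum_right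
    by (simp add: cinner_scaleC_left cinner_scaleC_right mult_ac)
  also have "\<dots> = (\<Sum>k<N. \<Sum>l<N. \<Sum>j<N. (\<omega> N j ^ k * cnj (\<omega> N j ^ l)) * cinner (a k) (b l))"
    by (subst sum.swap) (intro sum.cong refl sum.swap)
  also have "\<dots> = (\<Sum>k<N. \<Sum>l<N. (if k = l then of_nat N * cinner (a k) (b l) else 0))"
    unfolding sum_distrib_right [symmetric] \<omega>_def
    by (intro sum.cong refl) (simp only: sum_roots_of_unity_mult_cnj lessThan_iff if_distrib mult_zero_left,
      simp)
  also have "\<dots> = of_nat N * (\<Sum>k<N. cinner (a k) (b k))"
    by (simp add: sum_distrib_left)
  finally show ?thesis .
qed

lemma roots_of_unity_Parseval_norm:
  fixes a :: "nat \<Rightarrow> 'a::complex_hilbert_space"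
  shows "(\<Sum>j<N. (norm (\<Sum>k<N. cis (2 * pi * real j / real N) ^ k *\<^sub>C a k))\<^sup>2)
    = real N * (\<Sum>k<N. (norm (a k))\<^sup>2)"
proof -
  have "complex_of_real (\<Sum>j<N. (norm (\<Sum>k<N. cis (2 * pi * real j / real N) ^ k *\<^sub>C a k))\<^sup>2)
    = of_real (real N * (\<Sum>k<N. (norm (a k))\<^sup>2))"
    using roots_of_unity_Parseval [of N a a] unfolding cinner_self of_real_sum [symmetric] by simp
  then show ?thesis by (simp only: of_real_eq_iff)
qed

text \<open>Averages \<open>\<bar>\<langle>A x, x\<rangle>\<bar> \<le> norm x ^ 2\<close> and \<open>\<bar>\<langle>A x, x\<rangle>\<bar> \<le> norm (A x) ^ 2\<close> over the vectors
  \<open>x = (\<Sum>k. z ^ k * c k * A ^ k y)\<close>, \<open>z\<close> a root of unity.\<close>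

lemma averaged_numerical_bound:
  fixes A :: "'a::complex_hilbert_space \<Rightarrow> 'a" and c :: "nat \<Rightarrow> real"
  assumes A: "bounded_op A"
    and W: "\<And>x. cmod (cinner (A x) x) \<le> (norm x)\<^sup>2" "\<And>x. cmod (cinner (A x) x) \<le> (norm (A x))\<^sup>2"
    and c: "c n = 0"
  defines "g \<equiv> \<lambda>y k. (norm ((A ^^ k) y))\<^sup>2"
  shows "(\<Sum>k<n. c k * c (Suc k) * g y (Suc k)) \<le> (\<Sum>k<n. (c k)\<^sup>2 * g y k)" (is ?th1)
    and "(\<Sum>k<n. c k * c (Suc k) * g y (Suc k)) \<le> (\<Sum>k<n. (c k)\<^sup>2 * g y (Suc k))" (is ?th2)
proof -
  \<comment> \<open>One slot more than \<open>n\<close> makes room for the coefficients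
    \<open>c\<close> shifted by one place.\<close>
  define N where "N = Suc n"
  define \<omega> where "\<omega> j = cis (2 * pi * real j / real N)" for j
  define a where "a k = (if k = 0 then 0 else c (k - 1) *\<^sub>R (A ^^ k) y)" for k
  define b where "b k = c k *\<^sub>R (A ^^ k) y" for k
  define x where "x j = (\<Sum>k<N. \<omega> j ^ k *\<^sub>C b k)" for j
  have Ab: "A (b k) = c k *\<^sub>R (A ^^ Suc k) y" for k
    using bounded_op_scaleC [OF A] by (simp add: b_def scaleR_eq_scaleC)
  have Ax: "A (x j) = (\<Sum>k<N. \<omega> j ^ k *\<^sub>C A (b k))" for j
    by (simp add: x_def bounded_op_sum [OF A] bounded_op_scaleC [OF A])
  \<comment> \<open>Multiplication by \<open>\<omega> j\<close> aligns \<open>A (x j)\<close> with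
    the powers in \<open>x j\<close>, so Parseval pairs \<open>c (k - 1)\<close> with
    \<open>c k\<close> at \<open>A ^^ k\<close>. The overflowing top term is 0 because
    \<open>c n = 0\<close>.\<close>
  have wAx: "\<omega> j *\<^sub>C A (x j) = (\<Sum>k<N. \<omega> j ^ k *\<^sub>C a k)" for j
  proof -
    have "(\<Sum>k<N. \<omega> j ^ k *\<^sub>C a k) = (\<Sum>k<n. \<omega> j ^ Suc k *\<^sub>C A (b k))"
      unfolding N_def sum.lessThan_Suc_shift by (simp add: a_def Ab)
    also have "\<dots> = \<omega> j *\<^sub>C A (x j)"
      by (simp add: Ax scaleC_sum_right scaleC_scaleC N_def Ab c)
    finally show ?thesis by simp
  qed
  have scaled: "cinner (r *\<^sub>R u) (r' *\<^sub>R u) = of_real (r * r' * (norm u)\<^sup>2)" for r r' and u :: 'a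
    by (simp add: scaleR_eq_scaleC cinner_scaleC_left cinner_scaleC_right cinner_self)
  have "of_real (real N * (\<Sum>k<n. c k * c (Suc k) * g y (Suc k))) = of_nat N * (\<Sum>k<N. cinner (a k) (b k))"
    unfolding N_def sum.lessThan_Suc_shift [of _ n]
    by (simp add: a_def b_def g_def scaled del: funpow.simps)
  also have "\<dots> = (\<Sum>j<N. cinner (\<omega> j *\<^sub>C A (x j)) (x j))"
    unfolding wAx unfolding x_def \<omega>_def by (rule roots_of_unity_Parseval [symmetric])
  finally have eq: "of_real (real N * (\<Sum>k<n. c k * c (Suc k) * g y (Suc k)))
    = (\<Sum>j<N. cinner (\<omega> j *\<^sub>C A (x j)) (x j))" .
  have "real N * (\<Sum>k<n. c k * c (Suc k) * g y (Suc k))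
      \<le> cmod (of_real (real N * (\<Sum>k<n. c k * c (Suc k) * g y (Suc k))))"
    unfolding norm_of_real by (rule abs_ge_self)
  also have "\<dots> \<le> (\<Sum>j<N. cmod (cinner (A (x j)) (x j)))"
    unfolding eq by (rule order_trans [OF norm_sum]) (simp add: cinner_scaleC_left norm_mult \<omega>_def)
  finally have le: "real N * (\<Sum>k<n. c k * c (Suc k) * g y (Suc k)) \<le> (\<Sum>j<N. cmod (cinner (A (x j)) (x j)))" .
  have N: "real N > 0" by (simp add: N_def)
  have "(\<Sum>j<N. cmod (cinner (A (x j)) (x j))) \<le> (\<Sum>j<N. (norm (x j))\<^sup>2)" by (intro sum_mono W)
  also have "\<dots> = real N * (\<Sum>k<N. (norm (b k))\<^sup>2)"
    unfolding x_def \<omega>_def by (rule roots_of_unity_Parseval_norm)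
  also have "(\<Sum>k<N. (norm (b k))\<^sup>2) = (\<Sum>k<n. (c k)\<^sup>2 * g y k)"
    by (simp add: N_def b_def c power_mult_distrib g_def)
  finally have "real N * (\<Sum>k<n. c k * c (Suc k) * g y (Suc k)) \<le> real N * (\<Sum>k<n. (c k)\<^sup>2 * g y k)"
    using le by linarith
  then show ?th1 using N by (rule mult_left_le_imp_le)
  have "(\<Sum>j<N. cmod (cinner (A (x j)) (x j))) \<le> (\<Sum>j<N. (norm (A (x j)))\<^sup>2)" by (intro sum_mono W)
  also have "\<dots> = real N * (\<Sum>k<N. (norm (A (b k)))\<^sup>2)"
    unfolding Ax \<omega>_def by (rule roots_of_unity_Parseval_norm)
  also have "(\<Sum>k<N. (norm (A (b k)))\<^sup>2) = (\<Sum>k<n. (c k)\<^sup>2 * g y (Suc k))"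
    by (simp add: N_def Ab c power_mult_distrib g_def)
  finally have "real N * (\<Sum>k<n. c k * c (Suc k) * g y (Suc k))
    \<le> real N * (\<Sum>k<n. (c k)\<^sup>2 * g y (Suc k))"
    using le by linarith
  then show ?th2 using N by (rule mult_left_le_imp_le)
qed

text \<open>Summation by parts gives \<open>E = S + S' - 2 * X\<close>; as \<open>X\<close> is at
  most \<open>S\<close> and at most \<open>S'\<close>, \<open>E\<close> dominates both
  \<open>S' - S\<close> and \<open>S - S'\<close>. Both ends of \<open>c\<close> vanish so that
  shifting the index leaves \<open>S\<close> unchanged.\<close>

lemma averaged_numerical_bound_diff:
  fixes A :: "'a::complex_hilbert_space \<Rightarrow> 'a" and c :: "nat \<Rightarrow> real"
  assumes A: "bounded_op A"
    and W: "\<And>x. cmod (cinner (A x) x) \<le> (norm x)\<^sup>2" "\<And>x. cmod (cinner (A x) x) \<le> (norm (A x))\<^sup>2"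
    and c: "c 0 = 0" "c n = 0"
  defines "g \<equiv> \<lambda>y k. (norm ((A ^^ k) y))\<^sup>2"
  assumes M: "\<And>k. g y k \<le> M"
  shows "\<bar>\<Sum>k<n. (c k)\<^sup>2 * (g y (Suc k) - g y k)\<bar> \<le> M * (\<Sum>k<n. (c (Suc k) - c k)\<^sup>2)"
proof -
  define S where "S = (\<Sum>k<n. (c k)\<^sup>2 * g y k)"
  define S' where "S' = (\<Sum>k<n. (c k)\<^sup>2 * g y (Suc k))"
  define X where "X = (\<Sum>k<n. c k * c (Suc k) * g y (Suc k))"
  define E where "E = (\<Sum>k<n. (c (Suc k) - c k)\<^sup>2 * g y (Suc k))"
  have "X \<le> S" "X \<le> S'"
    unfolding X_def S_def S'_def g_def by (rule averaged_numerical_bound [where A = A and c = c and n = n and y = y], (rule A W c(2))+)+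
  moreover have "(\<Sum>k<n. (c (Suc k))\<^sup>2 * g y (Suc k)) = S"
  proof -
    have "(\<Sum>k<n. (c (Suc k))\<^sup>2 * g y (Suc k)) = (\<Sum>k<Suc n. (c k)\<^sup>2 * g y k)"
      unfolding sum.lessThan_Suc_shift by (simp add: c)
    then show ?thesis by (simp add: c S_def)
  qed
  then have "E = S + S' - 2 * X"
    by (simp add: E_def S'_def X_def power2_diff algebra_simps sum.distrib sum_subtractf sum_distrib_left)
  moreover have "E \<le> M * (\<Sum>k<n. (c (Suc k) - c k)\<^sup>2)"
    unfolding E_def sum_distrib_left mult.commute [of M] by (intro sum_mono mult_left_mono M) auto
  moreover have "(\<Sum>k<n. (c k)\<^sup>2 * (g y (Suc k) - g y k)) = S' - S"
    by (simp add: S_def S'_def algebra_simps sum_subtractf)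
  ultimately show ?thesis by linarith
qed

text \<open>The quadratic form \<open>M * \<Sum>(c (k + 1) - c k)\<^sup>2\<close> on the integers is critical: it dominates
  \<open>\<bar>\<Sum>(c k)\<^sup>2 * V k\<bar>\<close> for no nonzero \<open>V\<close>.  Test functions: a wide tent of height 1, raised by \<open>1 / s\<close>
  at its top.\<close>

lemma numerical_bound_isometry:
  fixes A :: "'a::complex_hilbert_space \<Rightarrow> 'a"
  assumes A: "invertible_op A"
    and C: "\<And>n x. norm ((A ^^ n) x) \<le> C * norm x" "\<And>n x. norm ((inv A ^^ n) x) \<le> C * norm x"
    and W: "\<And>x. cmod (cinner (A x) x) \<le> (norm x)\<^sup>2" "\<And>x. cmod (cinner (inv A x) x) \<le> (norm x)\<^sup>2"
  shows "norm (A y) = norm y"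
proof -
  have bA: "bounded_op A" using A by (rule invertible_op_bounded)
  note iA = invertible_op_inv [OF A]
  \<comment> \<open>The numerical bound for the inverse, evaluated at \<open>A x\<close>.\<close>
  have W': "cmod (cinner (A x) x) \<le> (norm (A x))\<^sup>2" for x
    using W(2)[of "A x"] by (simp add: iA) (metis cinner_commute complex_mod_cnj)
  define M where "M = (C * (C * norm y))\<^sup>2"
  define D where "D = (norm (A y))\<^sup>2 - (norm y)\<^sup>2"
  have "\<bar>D\<bar> * real s \<le> 5 * M" if s: "s > 0" for s
  proof -
    \<comment> \<open>With half-width \<open>L = s\<^sup>2\<close> and \<open>t = 1 / s\<close> the
      tent has energy at most \<open>2 / L = 2 * t\<^sup>2\<close>, the same order as the energy of
      a bump of height \<open>t\<close>. The bump changes \<open>F\<close> by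
      \<open>2 * t * D\<close> to first order, which forces \<open>D\<close> to be of order
      \<open>t\<close>.\<close>
    define L where "L = s\<^sup>2"
    have L: "L > 0" using s by (simp add: L_def)
    \<comment> \<open>The orbit starts \<open>L\<close> steps before \<open>y\<close>, so the top of
      the tent, at \<open>k = L\<close>, meets the increment \<open>D\<close> of
      \<open>g\<close>.\<close>
    define y' where "y' = (inv A ^^ L) y"
    define g where "g k = (norm ((A ^^ k) y'))\<^sup>2" for k
    have pow_inv: "(A ^^ n) ((inv A ^^ n) x) = x" for n x
      by (induction n arbitrary: x) (simp_all add: funpow_swap1 [of "inv A"] iA)
    have gM: "g k \<le> M" for k
    proof -
      have C0: "0 \<le> C * norm y" using C(1)[of 0 y] norm_ge_zero order_trans by blast
      have "norm ((A ^^ k) y') \<le> C * norm y'" by (rule C)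
      also have "\<dots> \<le> C * (C * norm y)"
      proof (cases "y = 0")
        case True
        then show ?thesis using C(2)[of L y] by (simp add: y'_def)
      next
        case False
        then have "C \<ge> 0" using C0 by (simp add: zero_le_mult_iff)
        then show ?thesis unfolding y'_def by (intro mult_left_mono C)
      qed
      finally show ?thesis unfolding g_def M_def by (intro power_mono) auto
    qed
    have M0: "M \<ge> 0" by (simp add: M_def)
    have gL: "g (Suc L) - g L = D"
      by (simp add: g_def y'_def D_def pow_inv)
    define F where "F c = (\<Sum>k<2*L. (c k)\<^sup>2 * (g (Suc k) - g k))" for c :: "nat \<Rightarrow> real"
    define E where "E c = (\<Sum>k<2*L. (c (Suc k) - c k)\<^sup>2)" for c :: "nat \<Rightarrow> real"
    have FE: "\<bar>F c\<bar> \<le> M * E c" if "c 0 = 0" "c (2 * L) = 0" for c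
      unfolding F_def E_def g_def
      by (rule averaged_numerical_bound_diff [OF bA W(1) W' that]) (rule gM [unfolded g_def])
    define h where "h k = 1 - \<bar>real k - real L\<bar> / real L" for k
    define e where "e k = (if k = L then 1 else 0 :: real)" for k
    define t where "t = 1 / real s"
    have t: "t > 0" "1 / real L = t\<^sup>2" using s by (auto simp: t_def L_def power_divide)
    have h0: "h 0 = 0" "h (2 * L) = 0" "h L = 1" using L by (auto simp: h_def)
    have "\<bar>h (Suc k) - h k\<bar> \<le> 1 / real L" for k
    proof -
      have "h (Suc k) - h k = (\<bar>real k - real L\<bar> - \<bar>real (Suc k) - real L\<bar>) / real L"
        by (simp add: h_def diff_divide_distrib)
      moreover have "\<bar>\<bar>real k - real L\<bar> - \<bar>real (Suc k) - real L\<bar>\<bar> \<le> 1" by simp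
      ultimately show ?thesis using L by (simp add: abs_divide divide_right_mono)
    qed
    then have sq: "(h (Suc k) - h k)\<^sup>2 \<le> (1 / real L)\<^sup>2" for k
      by (metis abs_le_square_iff abs_of_nonneg of_nat_0_le_iff zero_le_divide_1_iff)
    have Eh: "E h \<le> 2 * t\<^sup>2"
    proof -
      have "E h \<le> (\<Sum>k<2*L. (1 / real L)\<^sup>2)" unfolding E_def by (intro sum_mono sq)
      also have "\<dots> = 2 * (1 / real L)" using L by (simp add: power2_eq_square)
      finally show ?thesis by (simp only: t(2))
    qed
    \<comment> \<open>The spike \<open>e\<close> has just two nonzero increments, at
      \<open>L - 1\<close> and at \<open>L\<close>.\<close>
    have Ee: "E e \<le> 2"
    proof -
      have "E e \<le> (\<Sum>k<2*L. (if k = L - 1 then 1 else 0) + (if k = L then 1 else 0))"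
        unfolding E_def by (intro sum_mono) (auto simp: e_def)
      also have "\<dots> \<le> 2" unfolding sum.distrib by simp
      finally show ?thesis .
    qed
    define d where "d k = h k + t * e k" for k
    have "E d \<le> 2 * E h + 2 * t\<^sup>2 * E e"
      unfolding E_def sum_distrib_left sum.distrib [symmetric]
    proof (rule sum_mono)
      fix k
      have eq: "d (Suc k) - d k = h (Suc k) - h k + t * (e (Suc k) - e k)"
        by (simp add: d_def algebra_simps)
      have "(p + q)\<^sup>2 \<le> 2 * p\<^sup>2 + 2 * q\<^sup>2" for p q :: real
        using zero_le_power2 [of "p - q"] by (simp add: power2_eq_square algebra_simps)
      from this [of "h (Suc k) - h k" "t * (e (Suc k) - e k)"]
      show "(d (Suc k) - d k)\<^sup>2 \<le> 2 * (h (Suc k) - h k)\<^sup>2 + 2 * t\<^sup>2 * (e (Suc k) - e k)\<^sup>2"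
        unfolding eq by (simp only: power_mult_distrib mult.assoc)
    qed
    then have Ed: "E d \<le> 8 * t\<^sup>2"
      using Eh mult_left_mono [OF Ee, of "2 * t\<^sup>2"] by (simp add: mult.commute [of "E e"])
    \<comment> \<open>Only the summand at the top changes, by the factor
      \<open>(1 + t)\<^sup>2 - 1 = 2 * t + t\<^sup>2\<close>.\<close>
    have "F d - F h = (\<Sum>k<2*L. if k = L then (2 * t + t\<^sup>2) * D else 0)"
      unfolding F_def sum_subtractf [symmetric]
      by (intro sum.cong refl) (auto simp: d_def e_def h0 gL [symmetric] power2_eq_square algebra_simps)
    also have "\<dots> = (2 * t + t\<^sup>2) * D" using L by simp
    finally have "(2 * t + t\<^sup>2) * \<bar>D\<bar> = \<bar>F d - F h\<bar>" using t by (simp add: abs_mult)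
    also have "\<dots> \<le> M * E d + M * E h"
      using FE [of d] FE [of h] L by (simp add: h0 d_def e_def)
    also have "\<dots> \<le> M * (8 * t\<^sup>2) + M * (2 * t\<^sup>2)" by (intro add_mono mult_left_mono Ed Eh M0)
    finally have "(2 * t + t\<^sup>2) * \<bar>D\<bar> \<le> 10 * M * t\<^sup>2" by simp
    moreover have "2 * t * \<bar>D\<bar> \<le> (2 * t + t\<^sup>2) * \<bar>D\<bar>" by (intro mult_right_mono) auto
    ultimately have "2 * t * \<bar>D\<bar> \<le> 10 * M * t\<^sup>2" by (rule order_trans [rotated])
    then have "t * \<bar>D\<bar> \<le> t * (5 * M * t)" by (simp add: power2_eq_square mult_ac)
    then have "\<bar>D\<bar> \<le> 5 * M * t" using t by simp
    then show ?thesis using s by (simp add: t_def field_simps)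
  qed
  then have *: "real s * \<bar>D\<bar> \<le> 5 * M" if "s > 0" for s :: nat using that by (simp add: mult.commute)
  have "D = 0"
  proof (rule ccontr)
    assume "D \<noteq> 0"
    then obtain s where s: "real s * \<bar>D\<bar> > 5 * M" using reals_Archimedean3 [of "\<bar>D\<bar>"] by auto
    moreover have "s > 0"
      using s by (intro gr0I) (auto simp: M_def not_less)
    ultimately show False using * [of s] by simp
  qed
  then show ?thesis by (simp add: D_def)
qed

section \<open>Spectra of operators similar to unitary operators\<close>

lemma similar_op_unitary_invertible:
  assumes U: "unitary U" and sim: "similar_op A U"
  shows "invertible_op A" "similar_op (inv A) (adj U)"
proof -
  obtain Q where Q: "invertible_op Q" and A: "A = inv Q \<circ> U \<circ> Q"
    using sim by (auto simp: similar_op_def)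
  show iA: "invertible_op A"
    unfolding A by (intro invertible_op_compose invertible_op_inv_op Q unitary_invertible U)
  have "inv A = inv Q \<circ> adj U \<circ> Q"
  proof (rule invertible_opI(2))
    show "bounded_op A" by (rule invertible_op_bounded [OF iA])
    show "bounded_op (inv Q \<circ> adj U \<circ> Q)"
      using U by (simp add: bounded_op_compose invertible_op_inv(2) invertible_op_bounded Q bounded_op_adj unitary_def)
    have "adj U (U x) = x" "U (adj U x) = x" for x using U by (auto simp: unitary_def fun_eq_iff)
    then show "(inv Q \<circ> adj U \<circ> Q) (A x) = x" "A ((inv Q \<circ> adj U \<circ> Q) x) = x" for x
      by (simp_all add: A invertible_op_inv [OF Q])
  qed
  then show "similar_op (inv A) (adj U)" unfolding similar_op_def using Q by blast
qed

text \<open>\<open>norm (Q x)\<close> is an equivalent norm that \<open>A\<close> preserves.\<close>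

lemma similar_op_unitary_bounds:
  assumes U: "unitary U" and sim: "similar_op A U"
  shows "\<exists>c>0. \<exists>C. \<forall>n x. c * norm x \<le> norm ((A ^^ n) x) \<and> norm ((A ^^ n) x) \<le> C * norm x"
proof -
  obtain Q where Q: "invertible_op Q" and A: "A = inv Q \<circ> U \<circ> Q"
    using sim by (auto simp: similar_op_def)
  have QA: "norm (Q ((A ^^ n) x)) = norm (Q x)" for n x
  proof -
    have "norm (Q (A x)) = norm (Q x)" for x
      using U by (simp add: A invertible_op_inv [OF Q] unitary_norm)
    then show ?thesis by (induction n) auto
  qed
  obtain b where b: "b > 0" "\<And>x. b * norm x \<le> norm (Q x)" using invertible_op_bounded_below [OF Q] by blast
  obtain K where K: "K > 0" "\<And>x. norm (Q x) \<le> norm x * K"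
    using bounded_linear.pos_bounded [OF bounded_op_linear [OF invertible_op_bounded [OF Q]]] by blast
  show ?thesis
  proof (intro exI conjI allI)
    show "b / K > 0" using b K by simp
    fix n x
    have "b * norm x \<le> norm ((A ^^ n) x) * K" using b(2)[of x] K(2)[of "(A ^^ n) x"] QA[of n x] by simp
    then show "b / K * norm x \<le> norm ((A ^^ n) x)" using K by (simp add: field_simps)
    have "b * norm ((A ^^ n) x) \<le> norm x * K" using b(2)[of "(A ^^ n) x"] K(2)[of x] QA[of n x] by simp
    then show "norm ((A ^^ n) x) \<le> K / b * norm x" using b by (simp add: field_simps)
  qed
qed

text \<open>For \<open>cmod s > 1\<close> the map \<open>U / s\<close> is a strict contraction, so
  \<open>s - A\<close>, which is conjugate to \<open>s * (1 - U / s)\<close>, is invertible.\<close>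

lemma spectrum_similar_unitary_le:
  assumes U: "unitary U" and sim: "similar_op A U" and s: "s \<in> spectrum A"
  shows "cmod s \<le> 1"
proof (rule ccontr)
  assume "\<not> cmod s \<le> 1"
  then have s1: "cmod s > 1" by simp
  then have s0: "s \<noteq> 0" by auto
  have q: "1 / cmod s < 1" using s1 by (subst divide_less_eq_1_pos) auto
  obtain Q where Q: "invertible_op Q" and A: "A = inv Q \<circ> U \<circ> Q"
    using sim by (auto simp: similar_op_def)
  have bU: "bounded_op U" using U by (simp add: unitary_def)
  have 1: "invertible_op (\<lambda>x. x - (1 / s) *\<^sub>C U x)"
    by (rule invertible_op_id_minus_contraction [where q = "1 / cmod s"])
      (use q in \<open>auto simp: norm_scaleC unitary_norm [OF U] norm_divide bU intro: bounded_op_scaled\<close>)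
  have 2: "invertible_op (\<lambda>x::'a. s *\<^sub>C x)"
    by (rule invertible_opI(1) [where S = "\<lambda>x. (1 / s) *\<^sub>C x"])
      (use s0 bounded_op_scaled [OF bounded_op_id] in \<open>auto simp: scaleC_scaleC\<close>)
  have "invertible_op (inv Q \<circ> ((\<lambda>x. s *\<^sub>C x) \<circ> (\<lambda>x. x - (1 / s) *\<^sub>C U x)) \<circ> Q)"
    by (intro invertible_op_compose invertible_op_inv_op Q 1 2)
  also have "inv Q \<circ> ((\<lambda>x. s *\<^sub>C x) \<circ> (\<lambda>x. x - (1 / s) *\<^sub>C U x)) \<circ> Q = (\<lambda>x. s *\<^sub>C x - A x)"
    using s0 invertible_op_inv(2) [OF Q]
    by (auto simp: fun_eq_iff A scaleC_diff_right scaleC_scaleC bounded_op_diff bounded_op_scaleC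
        invertible_op_inv [OF Q])
  finally show False using s by (simp add: spectrum_def)
qed

text \<open>For a root of unity \<open>z\<close> of order \<open>N\<close> and \<open>x = (\<Sum>k<N. z ^ k * A ^ k y)\<close>, \<open>z A x - x = A ^ N y - y\<close> stays
  bounded, while the average of \<open>norm x ^ 2\<close> grows like \<open>N\<close>: approximate eigenvectors exist.\<close>

lemma spectrum_nonempty:
  fixes A :: "'a::complex_hilbert_space \<Rightarrow> 'a"
  assumes A: "bounded_op A" and y: "y \<noteq> (0::'a)"
    and c: "c > 0" "\<And>n x. c * norm x \<le> norm ((A ^^ n) x)"
    and C: "\<And>n x. norm ((A ^^ n) x) \<le> C * norm x"
  shows "spectrum A \<noteq> {}"
proof
  assume empty: "spectrum A = {}"
  define K where "K = (C + 1) * norm y"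
  have ex: "\<exists>z x. cmod z = 1 \<and> x \<noteq> 0 \<and> sqrt (real N) * (c * norm y) * norm (z *\<^sub>C x - A x) \<le> K * norm x"
    if N: "N > 0" for N
  proof -
    define \<omega> where "\<omega> j = cis (2 * pi * real j / real N)" for j
    have \<omega>: "\<omega> j ^ N = 1" "cmod (\<omega> j) = 1" "cnj (\<omega> j) * \<omega> j = 1" for j
      using N cis_multiple_2pi [of "real j"] by (auto simp: \<omega>_def Complex.DeMoivre cis_cnj cis_mult)
    define x where "x j = (\<Sum>k<N. \<omega> j ^ k *\<^sub>C (A ^^ k) y)" for j
    have "(\<Sum>j<N. real N * (c * norm y)\<^sup>2) \<le> real N * (\<Sum>k<N. (norm ((A ^^ k) y))\<^sup>2)"
    proof -
      have "(\<Sum>k<N. (c * norm y)\<^sup>2) \<le> (\<Sum>k<N. (norm ((A ^^ k) y))\<^sup>2)"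
        using c by (intro sum_mono power_mono) auto
      then show ?thesis by (simp add: mult_left_mono)
    qed
    also have "\<dots> = (\<Sum>j<N. (norm (x j))\<^sup>2)"
      unfolding x_def \<omega>_def by (rule roots_of_unity_Parseval_norm [symmetric])
    finally have le: "(\<Sum>j<N. real N * (c * norm y)\<^sup>2) \<le> (\<Sum>j<N. (norm (x j))\<^sup>2)" .
    \<comment> \<open>Some \<open>x j\<close> reaches the average of the squared norms.\<close>
    obtain j where "real N * (c * norm y)\<^sup>2 \<le> (norm (x j))\<^sup>2"
    proof (rule ccontr)
      assume "\<not> thesis"
      then have "\<And>j. (norm (x j))\<^sup>2 < real N * (c * norm y)\<^sup>2" using that not_le by blast
      then have "(\<Sum>j<N. (norm (x j))\<^sup>2) < (\<Sum>j<N. real N * (c * norm y)\<^sup>2)"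
        using N by (intro sum_strict_mono) auto
      then show False using le by linarith
    qed
    then have "(sqrt (real N) * (c * norm y))\<^sup>2 \<le> (norm (x j))\<^sup>2" by (simp add: power_mult_distrib)
    then have big: "sqrt (real N) * (c * norm y) \<le> norm (x j)" by (rule power2_le_imp_le) simp
    have "\<omega> j *\<^sub>C A (x j) - x j = (\<Sum>k<N. \<omega> j ^ Suc k *\<^sub>C (A ^^ Suc k) y - \<omega> j ^ k *\<^sub>C (A ^^ k) y)"
      by (simp add: x_def bounded_op_sum [OF A] bounded_op_scaleC [OF A] scaleC_sum_right scaleC_scaleC sum_subtractf)
    also have "\<dots> = (A ^^ N) y - y"
      by (subst sum_lessThan_telescope [of "\<lambda>k. \<omega> j ^ k *\<^sub>C (A ^^ k) y"]) (simp add: \<omega>)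
    finally have eq: "\<omega> j *\<^sub>C A (x j) - x j = (A ^^ N) y - y" .
    have "cnj (\<omega> j) *\<^sub>C x j - A (x j) = - (cnj (\<omega> j) *\<^sub>C (\<omega> j *\<^sub>C A (x j) - x j))"
      by (simp add: scaleC_diff_right scaleC_scaleC \<omega>)
    then have "norm (cnj (\<omega> j) *\<^sub>C x j - A (x j)) = norm ((A ^^ N) y - y)"
      by (simp add: eq norm_scaleC \<omega>)
    also have "\<dots> \<le> K" using norm_triangle_ineq4 [of "(A ^^ N) y" y] C [of N y] by (simp add: K_def algebra_simps)
    finally have small: "norm (cnj (\<omega> j) *\<^sub>C x j - A (x j)) \<le> K" .
    show ?thesis
    proof (intro exI conjI)
      show "cmod (cnj (\<omega> j)) = 1" by (simp add: \<omega>)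
      have "0 < sqrt (real N) * (c * norm y)" using N c(1) y by simp
      then show "x j \<noteq> 0" using big by auto
      show "sqrt (real N) * (c * norm y) * norm (cnj (\<omega> j) *\<^sub>C x j - A (x j)) \<le> K * norm (x j)"
        unfolding mult.commute [of K] by (intro mult_mono big small) auto
    qed
  qed
  then have "\<forall>n. \<exists>z x. cmod z = 1 \<and> x \<noteq> 0 \<and>
      sqrt (real (Suc n)) * (c * norm y) * norm (z *\<^sub>C x - A x) \<le> K * norm x" by blast
  then obtain z x where zx: "\<And>n. cmod (z n) = 1" "\<And>n. x n \<noteq> 0"
    "\<And>n. sqrt (real (Suc n)) * (c * norm y) * norm (z n *\<^sub>C x n - A (x n)) \<le> K * norm (x n)"
    by metis
  have "\<forall>n. z n \<in> sphere 0 1" using zx(1) by simp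
  then obtain l r where r: "strict_mono r" "(z \<circ> r) \<longlonglongrightarrow> l"
    using compact_sphere [of "0::complex" 1] unfolding compact_def by metis
  have "invertible_op (\<lambda>x. l *\<^sub>C x - A x)" using empty by (auto simp: spectrum_def)
  then obtain d where d: "d > 0" "\<And>x. d * norm x \<le> norm (l *\<^sub>C x - A x)"
    using invertible_op_bounded_below by blast
  have "d \<le> cmod (l - z n) + (1 / sqrt (real (Suc n))) * (K / (c * norm y))" for n
  proof -
    define s where "s = sqrt (real (Suc n)) * (c * norm y)"
    have s: "s > 0" using c y by (simp add: s_def)
    have "d * norm (x n) \<le> norm (l *\<^sub>C x n - A (x n))" by (rule d)
    also have "l *\<^sub>C x n - A (x n) = (l - z n) *\<^sub>C x n + (z n *\<^sub>C x n - A (x n))"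
      using scaleC_add_left [of "l - z n" "z n" "x n"] by simp
    also have "norm \<dots> \<le> cmod (l - z n) * norm (x n) + norm (z n *\<^sub>C x n - A (x n))"
      by (metis norm_scaleC norm_triangle_ineq)
    also have "norm (z n *\<^sub>C x n - A (x n)) \<le> K * norm (x n) / s"
      using zx(3)[of n] s by (simp add: s_def field_simps)
    finally have "d * norm (x n) \<le> (cmod (l - z n) + K / s) * norm (x n)" by (simp add: algebra_simps)
    then have "d \<le> cmod (l - z n) + K / s" by (rule mult_right_le_imp_le) (simp add: zx(2))
    then show ?thesis by (simp add: s_def)
  qed
  then have dle: "d \<le> cmod (l - (z \<circ> r) n) + (1 / sqrt (real (Suc (r n)))) * (K / (c * norm y))" for n by simp
  have "(\<lambda>n. cmod (l - (z \<circ> r) n) + (1 / sqrt (real (Suc (r n)))) * (K / (c * norm y)))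
      \<longlonglongrightarrow> cmod (l - l) + 0 * (K / (c * norm y))"
  proof (intro tendsto_intros r)
    have "(\<lambda>n. sqrt (1 / real (Suc n))) \<longlonglongrightarrow> sqrt 0"
      by (intro tendsto_intros LIMSEQ_Suc [OF lim_1_over_n])
    then have "(\<lambda>n. 1 / sqrt (real (Suc n))) \<longlonglongrightarrow> 0" by (simp add: real_sqrt_divide)
    then show "(\<lambda>n. 1 / sqrt (real (Suc (r n)))) \<longlonglongrightarrow> 0"
      using LIMSEQ_subseq_LIMSEQ [OF _ r(1)] unfolding comp_def by blast
  qed
  then have "d \<le> cmod (l - l) + 0 * (K / (c * norm y))"
    by (rule tendsto_lowerbound) (rule always_eventually, rule allI, rule dle, simp)
  then show False using d by simp
qed

text \<open>Each of the three properties confines the numerical range to the closed unit disc: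
  through the norm, through the convex hull of the spectrum, or through the numerical radius. The
  spectrum is required to be nonempty only when a nonzero vector exists, because it is empty on the
  zero space.\<close>

lemma numerical_range_bound:
  fixes A :: "'a::complex_hilbert_space \<Rightarrow> 'a"
  assumes A: "bounded_op A"
    and spec: "\<And>y::'a. y \<noteq> 0 \<Longrightarrow> spectrum A \<noteq> {}" "\<And>s. s \<in> spectrum A \<Longrightarrow> cmod s \<le> 1"
    and n: "normaloid A \<or> convexoid A \<or> spectraloid A"
  shows "cmod (cinner (A x) x) \<le> (norm x)\<^sup>2"
proof (cases "x = 0")
  case False
  \<comment> \<open>A supremum over the empty set would carry no information, hence the appeal to
    nonemptiness.\<close>
  have radius: "spectral_radius A \<le> 1"
    unfolding spectral_radius_def using spec(1) [OF False] spec(2) by (intro cSup_least) auto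
  have unit: "cmod (cinner (A u) u) \<le> onorm A" if "norm u = 1" for u
    using norm_cinner_le [of "A u" u] bounded_op_norm_le [OF A, of u] that by simp
  have range: "cmod s \<le> 1" if "s \<in> numerical_range A" for s
    using n
  proof (elim disjE)
    assume "normaloid A"
    then show ?thesis using radius unit that by (force simp: normaloid_def numerical_range_def)
  next
    assume "convexoid A"
    then have "s \<in> convex hull (spectrum A)"
      using that closure_subset by (auto simp: convexoid_def)
    moreover have "convex hull (spectrum A) \<subseteq> cball 0 1"
      using spec(2) by (intro hull_minimal) auto
    ultimately show ?thesis by auto
  next
    assume sp: "spectraloid A"
    have "bdd_above {cmod s | s. s \<in> numerical_range A}"
      using unit by (auto simp: numerical_range_def intro!: bdd_aboveI [of _ "onorm A"])
    then have "cmod s \<le> numerical_radius A"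
      unfolding numerical_radius_def using that by (intro cSup_upper) auto
    then show ?thesis using sp radius by (simp add: spectraloid_def)
  qed
  define u where "u = (1 / complex_of_real (norm x)) *\<^sub>C x"
  have "norm u = 1" using False by (simp add: u_def norm_scaleC norm_divide)
  then have le: "cmod (cinner (A u) u) \<le> 1" by (intro range) (auto simp: numerical_range_def)
  have x: "x = complex_of_real (norm x) *\<^sub>C u" using False by (simp add: u_def scaleC_scaleC)
  have "cinner (A x) x = of_real ((norm x)\<^sup>2) * cinner (A u) u"
    by (subst (1 2) x) (simp add: bounded_op_scaleC [OF A] cinner_scaleC_left cinner_scaleC_right
      power2_eq_square)
  then have "cmod (cinner (A x) x) = (norm x)\<^sup>2 * cmod (cinner (A u) u)" by (simp add: norm_mult norm_power)
  also have "\<dots> \<le> (norm x)\<^sup>2" using le by (simp add: mult_left_le)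
  finally show ?thesis .
qed (simp add: bounded_op_zero [OF A])

text \<open>\<open>A\<close> and \<open>inv A\<close> are both similar to unitary operators, so both
  have bounded powers and numerical radius at most 1. This makes \<open>A\<close> isometric, and a
  surjective isometry is unitary.\<close>

lemma similar_unitary_imp_unitary:
  fixes A :: "'a::complex_hilbert_space \<Rightarrow> 'a"
  assumes U: "unitary U" and sim: "similar_op A U"
    and n: "normaloid A \<or> convexoid A \<or> spectraloid A"
      "normaloid (inv A) \<or> convexoid (inv A) \<or> spectraloid (inv A)"
  shows "unitary A"
proof -
  have A: "invertible_op A" and sim': "similar_op (inv A) (adj U)"
    using similar_op_unitary_invertible [OF U sim] by auto
  have U': "unitary (adj U)" using U by (rule unitary_invertible)
  have W: "cmod (cinner (T x) x) \<le> (norm x)\<^sup>2"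
    if V: "unitary V" "similar_op T V" "normaloid T \<or> convexoid T \<or> spectraloid T" for T V :: "'a \<Rightarrow> 'a" and x
  proof -
    have T: "bounded_op T" using V similar_op_unitary_invertible invertible_op_bounded by blast
    obtain c C where c: "c > 0" "\<And>n x. c * norm x \<le> norm ((T ^^ n) x)" "\<And>n x. norm ((T ^^ n) x) \<le> C * norm x"
      using similar_op_unitary_bounds [OF V(1,2)] by blast
    have ne: "spectrum T \<noteq> {}" if "y \<noteq> 0" for y :: 'a
      by (rule spectrum_nonempty [where A = T and y = y and c = c and C = C]) (rule T that c)+
    show ?thesis
    proof (rule numerical_range_bound [where A = T, OF T _ _ V(3)])
      show "spectrum T \<noteq> {}" if "y \<noteq> 0" for y :: 'a using that by (rule ne)
      show "cmod s \<le> 1" if "s \<in> spectrum T" for s using V(1,2) that by (rule spectrum_similar_unitary_le)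
    qed
  qed
  obtain b C where C: "b > 0" "\<And>n x. b * norm x \<le> norm ((A ^^ n) x)"
    "\<And>n x. norm ((A ^^ n) x) \<le> C * norm x"
    using similar_op_unitary_bounds [OF U sim] by blast
  obtain b' C' where C': "b' > 0" "\<And>n x. b' * norm x \<le> norm ((inv A ^^ n) x)"
    "\<And>n x. norm ((inv A ^^ n) x) \<le> C' * norm x"
    using similar_op_unitary_bounds [OF U' sim'] by blast
  define M where "M = max C C'"
  have M: "norm ((A ^^ n) x) \<le> M * norm x" "norm ((inv A ^^ n) x) \<le> M * norm x" for n x
    using C(3) [of n x] mult_right_mono [of C M "norm x"] C'(3) [of n x] mult_right_mono [of C' M "norm x"]
    by (auto simp: M_def)
  have "norm (A y) = norm y" for y
    by (rule numerical_bound_isometry [where A = A and C = M]) (rule A M W [OF U sim n(1)] W [OF U' sim' n(2)])+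
  then show ?thesis
    using invertible_op_inv(1) [OF A] by (intro unitaryI invertible_op_bounded A) (auto simp: bij_def)
qed

section \<open>Biisometric pairs with surjective \<open>B\<close>, and the two halves of the
  theorem\<close>

lemma biisometric_invertible_similar_unitary:
  fixes A B P :: "'a::complex_hilbert_space \<Rightarrow> 'a"
  assumes A: "power_bounded A" and B: "power_bounded B" and P: "invertible_op P" "adj P = P"
    and AB: "\<And>x. adj A (P (B x)) = P x" and surj: "surj B"
  obtains U where "unitary U" "similar_op A U" "similar_op B U"
proof -
  have bA: "bounded_op A" and bB: "bounded_op B" using A B by (auto simp: power_bounded_def)
  have bP: "bounded_op P" using P(1) by (rule invertible_op_bounded)
  note iP = invertible_op_inv [OF P(1)]
  have BA: "adj B (P (A x)) = P x" for x by (rule biisometric_adj [OF bA bB bP P(2) AB])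
  obtain a where a: "a > 0" "\<And>x. a * norm x \<le> norm (P x)" using invertible_op_bounded_below [OF P(1)] by blast
  obtain KP where KP: "KP > 0" "\<And>x. norm (P x) \<le> norm x * KP"
    using bounded_linear.pos_bounded [OF bounded_op_linear [OF bP]] by blast
  obtain CA where CA: "CA > 0" "\<And>n x. norm ((A ^^ n) x) \<le> CA * norm x" using A power_bounded_bound by blast
  obtain CB where CB: "CB > 0" "\<And>n x. norm ((B ^^ n) x) \<le> CB * norm x" using B power_bounded_bound by blast
  have inner_pow: "cinner (P ((A ^^ n) x)) ((B ^^ n) y) = cinner (P x) y" for n x y
  proof (induction n)
    case (Suc n)
    have "cinner (P (A u)) (B v) = cinner (P u) v" for u v by (metis BA cinner_adj' [OF bB])
    then show ?case using Suc by simp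
  qed simp
  \<comment> \<open>Pairing \<open>P ((A ^^ n) x)\<close> with \<open>(B ^^ n) (P x)\<close>
    recovers \<open>norm (P x) ^ 2\<close>, so an upper bound for the powers of \<open>B\<close> is
    a lower bound for those of \<open>A\<close>.\<close>
  have below: "a / (KP * CB) * norm x \<le> norm ((A ^^ n) x)" for n x
  proof (cases "x = 0")
    case False
    have nP: "norm (P x) > 0" using a(2)[of x] mult_pos_pos [OF a(1), of "norm x"] False
      by (metis less_le_trans zero_less_norm_iff)
    have "norm (P x) * norm (P x) = cmod (cinner (P x) (P x))"
      by (simp add: cinner_self norm_mult power2_eq_square)
    also have "\<dots> = cmod (cinner (P ((A ^^ n) x)) ((B ^^ n) (P x)))" by (simp add: inner_pow)
    also have "\<dots> \<le> norm (P ((A ^^ n) x)) * norm ((B ^^ n) (P x))" by (rule norm_cinner_le)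
    also have "\<dots> \<le> (norm ((A ^^ n) x) * KP) * (CB * norm (P x))"
      using KP CB by (intro mult_mono) auto
    finally have "norm (P x) * norm (P x) \<le> (norm ((A ^^ n) x) * KP * CB) * norm (P x)" by (simp add: mult_ac)
    then have "norm (P x) \<le> norm ((A ^^ n) x) * KP * CB" by (rule mult_right_le_imp_le) (rule nP)
    then have "a * norm x \<le> norm ((A ^^ n) x) * KP * CB" using a(2)[of x] by linarith
    then show ?thesis using KP(1) CB(1) by (simp add: field_simps)
  qed simp
  \<comment> \<open>\<open>adj A (P (B x)) = P x\<close> bounds \<open>B\<close> below, so
    surjectivity makes \<open>B\<close> invertible; solving the identity for \<open>adj A\<close>
    gives a product of invertible operators.\<close>
  have adjA: "invertible_op (adj A)"
  proof -
    obtain K where K: "K > 0" "\<And>x. norm (adj A x) \<le> norm x * K"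
      using bounded_linear.pos_bounded [OF bounded_op_linear [OF bounded_op_adj [OF bA]]] by blast
    have iB: "invertible_op B"
    proof (rule invertible_opI_bounded_below [OF bB surj])
      show "a / (KP * K) > 0" using a KP K by simp
      show "a / (KP * K) * norm x \<le> norm (B x)" for x
      proof -
        have "a * norm x \<le> norm (adj A (P (B x)))" using a(2)[of x] by (simp add: AB)
        also have "\<dots> \<le> norm (P (B x)) * K" by (rule K)
        also have "\<dots> \<le> norm (B x) * KP * K" using K KP by (intro mult_right_mono) auto
        finally show ?thesis using KP(1) K(1) by (simp add: field_simps)
      qed
    qed
    have "adj A = P \<circ> inv B \<circ> inv P"
    proof
      fix x
      show "adj A x = (P \<circ> inv B \<circ> inv P) x"
        using AB [of "inv B (inv P x)"] by (simp add: invertible_op_inv [OF iB] iP)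
    qed
    then show ?thesis using iB P by (simp add: invertible_op_compose invertible_op_inv_op)
  qed
  then have iA: "invertible_op A" using invertible_op_adj(1) [OF adjA] by (simp add: adj_adj bA)
  obtain U where U: "unitary U" "similar_op A U"
    using Sz_Nagy_similarity [OF iA CA _ below] a KP CB by auto
  obtain Q where Q: "invertible_op Q" and AQ: "A = inv Q \<circ> U \<circ> Q"
    using U(2) by (auto simp: similar_op_def)
  note iQ = invertible_op_inv [OF Q]
  have bQ: "bounded_op Q" "bounded_op (inv Q)" "bounded_op U"
    using Q invertible_op_bounded iQ U(1) by (auto simp: unitary_def)
  \<comment> \<open>The same \<open>U\<close> serves \<open>B\<close>: inserting
    \<open>adj A = adj Q \<circ> adj U \<circ> inv (adj Q)\<close> into the identity gives
    \<open>S \<circ> B = U \<circ> S\<close> for this \<open>S\<close>.\<close>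
  define S where "S = inv (adj Q) \<circ> P"
  have adjA_eq: "adj A = adj Q \<circ> (adj U \<circ> inv (adj Q))"
    unfolding AQ by (simp add: adj_compose bQ bounded_op_compose invertible_op_adj(2) [OF Q])
  note iaQ = invertible_op_inv [OF invertible_op_adj(1) [OF Q]]
  have UU: "U (adj U x) = x" for x using U(1) by (auto simp: unitary_def fun_eq_iff)
  have SB: "S (B x) = U (S x)" for x
  proof -
    have "adj Q (adj U (S (B x))) = P x" using AB [of x] by (simp add: adjA_eq S_def)
    then have "adj U (S (B x)) = S x" by (metis S_def comp_apply iaQ(3))
    then show ?thesis by (metis UU)
  qed
  have iS: "invertible_op S"
    unfolding S_def by (intro invertible_op_compose invertible_op_inv_op invertible_op_adj Q P)
  have "similar_op B U"
    unfolding similar_op_def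
  proof (intro exI [of _ S] conjI iS ext)
    show "B x = (inv S \<circ> U \<circ> S) x" for x
      by (simp add: invertible_op_inv [OF iS] flip: SB)
  qed
  then show thesis using that U by blast
qed

text \<open>\<open>A\<close> inverts \<open>adj A\<close>, so the identity becomes
  \<open>P \<circ> B = A \<circ> P\<close>.\<close>

lemma biisometric_unitary:
  assumes A: "unitary A" and P: "invertible_op P" and AB: "\<And>x. adj A (P (B x)) = P x"
  shows "B = inv P \<circ> A \<circ> P"
proof
  fix x
  have "A (adj A (P (B x))) = P (B x)" using A by (simp add: unitary_def fun_eq_iff)
  then show "B x = (inv P \<circ> A \<circ> P) x" by (simp add: AB) (metis invertible_op_inv(3) [OF P])
qed

theorem theorem6p1:
  fixes A B P :: "'a::complex_hilbert_space \<Rightarrow> 'a" and m :: nat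
  assumes "power_bounded A" and "power_bounded B"
    and "m > 0"
    and "strictly_positive P"
    and "biisometric_pair m P A B"
  shows "((\<exists>U. unitary U \<and> similar_op A U \<and> similar_op B U)
          \<or> (\<exists>v w. v \<noteq> 0 \<and> v \<in> kernel_op (adj A) \<and> w \<noteq> 0 \<and> w \<in> kernel_op (adj B) \<and>
               (let \<phi> = (\<lambda>n. (A ^^ n) (inv P w)); \<psi> = (\<lambda>n. (B ^^ n) (inv P v)) in
                  biorthogonal_wrt P \<phi> \<psi> \<and>
                  (\<forall>n. A (\<phi> n) = \<phi> (Suc n) \<and> B (\<psi> n) = \<psi> (Suc n) \<and>
                       adj A (P (\<psi> (Suc n))) = P (\<psi> n) \<and>
                       adj B (P (\<phi> (Suc n))) = P (\<phi> n)))))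
       \<and> ((\<exists>U. unitary U \<and> similar_op A U \<and> similar_op B U) \<longrightarrow>
            ((normaloid A \<or> convexoid A \<or> spectraloid A) \<and>
             (normaloid (inv A) \<or> convexoid (inv A) \<or> spectraloid (inv A)) \<longrightarrow>
               unitary A \<and> B = inv P \<circ> A \<circ> P) \<and>
            ((normaloid B \<or> convexoid B \<or> spectraloid B) \<and>
             (normaloid (inv B) \<or> convexoid (inv B) \<or> spectraloid (inv B)) \<longrightarrow>
               unitary B \<and> A = inv P \<circ> B \<circ> P))"
proof -
  have P: "bounded_op P" "adj P = P" "invertible_op P"
    using assms(4) by (auto simp: strictly_positive_def)
  have A: "bounded_op A" and B: "bounded_op B"
    using assms(1,2) by (auto simp: power_bounded_def)
  have AB: "adj A (P (B x)) = P x" for x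
    by (rule biisometric_power_bounded [OF assms(1-3) P(1) assms(5)])
  have BA: "adj B (P (A x)) = P x" for x
    by (rule biisometric_adj [OF A B P(1,2) AB])
  have "(\<exists>U. unitary U \<and> similar_op A U \<and> similar_op B U)
          \<or> (\<exists>v w. v \<noteq> 0 \<and> v \<in> kernel_op (adj A) \<and> w \<noteq> 0 \<and> w \<in> kernel_op (adj B) \<and>
               (let \<phi> = (\<lambda>n. (A ^^ n) (inv P w)); \<psi> = (\<lambda>n. (B ^^ n) (inv P v)) in
                  biorthogonal_wrt P \<phi> \<psi> \<and>
                  (\<forall>n. A (\<phi> n) = \<phi> (Suc n) \<and> B (\<psi> n) = \<psi> (Suc n) \<and>
                       adj A (P (\<psi> (Suc n))) = P (\<psi> n) \<and>
                       adj B (P (\<phi> (Suc n))) = P (\<phi> n))))"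
  \<comment> \<open>\<open>B\<close> has a bounded left inverse in any case, so surjectivity alone
    decides whether it is invertible.\<close>
  proof (cases "surj B")
    case True
    obtain U where "unitary U" "similar_op A U" "similar_op B U"
      using biisometric_invertible_similar_unitary [OF assms(1,2) P(3,2) AB True] .
    then show ?thesis by blast
  next
    case False
    obtain v w where vw: "v \<noteq> 0" "adj A v = 0" "w \<noteq> 0" "adj B w = 0" "cinner (inv P w) v = 1"
      using biorthogonal_generators [OF A B P(3,2) AB False] .
    note biorthogonal_generators_system [OF A B P(3,2) AB vw(2,4,5)]
    then show ?thesis
      using vw by (intro disjI2 exI [of _ v] exI [of _ w]) (simp add: kernel_op_def AB BA)
  qed
  moreover have "unitary A \<and> B = inv P \<circ> A \<circ> P"
    if "unitary U" "similar_op A U" "normaloid A \<or> convexoid A \<or> spectraloid A"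
      "normaloid (inv A) \<or> convexoid (inv A) \<or> spectraloid (inv A)" for U
    using similar_unitary_imp_unitary [OF that] biisometric_unitary [OF _ P(3) AB] by blast
  \<comment> \<open>The roles of \<open>A\<close> and \<open>B\<close> are exchanged through
    \<open>BA\<close>; unitarity of \<open>B\<close> yields
    \<open>P \<circ> A = B \<circ> P\<close>, with \<open>P\<close> on the same sides as in the
    first half.\<close>
  moreover have "unitary B \<and> A = inv P \<circ> B \<circ> P"
    if "unitary U" "similar_op B U" "normaloid B \<or> convexoid B \<or> spectraloid B"
      "normaloid (inv B) \<or> convexoid (inv B) \<or> spectraloid (inv B)" for U
    using similar_unitary_imp_unitary [OF that] biisometric_unitary [OF _ P(3) BA] by blast
  ultimately show ?thesis by blast
qed

end
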